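(* Let $n\ge 1$ and let $\mathfrak B$ be a finite-dimensional unital associative algebra over $\mathbb C$ with $\operatorname{ind}\mathfrak B=1$. Then $$\operatorname{ind}\left(\mathrm{Mat}_n\otimes\mathfrak B\right)=n .$$
   Context: $\mathrm{Mat}_n$ is the algebra of $n\times n$ complex matrices, and $\otimes=\otimes_{\mathbb C}$ is the tensor product of associative algebras. For a finite-dimensional associative algebra $\mathfrak A$ over $\mathbb C$ and a linear functional $F\in\mathfrak A^*$, put $\mathrm{Stab}_F(1)=\{a\in\mathfrak A: F(ax)=F(xa)\text{ for all }x\in\mathfrak A\}$. A functional $F$ is called $1$-regular if $\dim\mathrm{Stab}_F(1)$ is smallest among all functionals in a neighbourhood of $F$ in $\mathfrak A^*$. The index of $\mathfrak A$ is $\operatorname{ind}\mathfrak A:=\dim\mathrm{Stab}_F(1)$ for a $1$-regular $F$ (equivalently, the minimum of $\dim\mathrm{Stab}_F(1)$ over $F\in\mathfrak A^*$; it is the index of the Lie algebra $\mathfrak A$ with bracket $[a,b]=ab-ba$). *)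

theory Defs
  imports "HOL-Analysis.Analysis" "HOL-Library.Poly_Mapping"
begin

section \<open>Associative algebras over the complex numbers\<close>

class scaleC =
  fixes scaleC :: "complex \<Rightarrow> 'a \<Rightarrow> 'a" (infixr "*\<^sub>C" 75)

class complex_vector = scaleC + ab_group_add +
  assumes scaleC_add_right: "a *\<^sub>C (x + y) = a *\<^sub>C x + a *\<^sub>C y"
    and scaleC_add_left: "(a + b) *\<^sub>C x = a *\<^sub>C x + b *\<^sub>C x"
    and scaleC_scaleC: "a *\<^sub>C b *\<^sub>C x = (a * b) *\<^sub>C x"
    and scaleC_one: "1 *\<^sub>C x = x"

text \<open>As for \<^class>\<open>real_algebra\<close>, a unit is only required in the subclass with suffix 1.\<close>

class complex_algebra = complex_vector + ring +
  assumes mult_scaleC_left: "a *\<^sub>C x * y = a *\<^sub>C (x * y)"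
    and mult_scaleC_right: "x * a *\<^sub>C y = a *\<^sub>C (x * y)"

class complex_algebra_1 = complex_algebra + ring_1

global_interpretation complex_vector: vector_space "scaleC :: complex \<Rightarrow> 'a \<Rightarrow> 'a::complex_vector"
  by unfold_locales (simp_all add: scaleC_add_right scaleC_add_left scaleC_scaleC scaleC_one)

instantiation complex :: complex_algebra_1
begin

definition scaleC_complex :: "complex \<Rightarrow> complex \<Rightarrow> complex" where
  "scaleC_complex = (*)"

instance
  by standard (simp_all add: scaleC_complex_def algebra_simps)

end

definition finite_dim :: "'a::complex_vector itself \<Rightarrow> bool" where
  "finite_dim _ \<longleftrightarrow> (\<exists>S :: 'a set. finite S \<and> complex_vector.span S = UNIV)"


section \<open>The index\<close>

definition dual_space :: "('a::complex_vector \<Rightarrow> complex) set" where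
  "dual_space = {F. Vector_Spaces.linear scaleC scaleC F}"

definition stab :: "('a::complex_algebra \<Rightarrow> complex) \<Rightarrow> 'a set" where
  "stab F = {a. \<forall>x. F (a * x) = F (x * a)}"

text \<open>
  Neighbourhoods in the dual are taken in the topology of pointwise convergence, i.e.\ the subspace
  topology of the product topology on \<^typ>\<open>'a \<Rightarrow> complex\<close>.  On the dual of a finite-dimensional
  space this is the usual (unique Hausdorff vector space) topology.
\<close>

definition one_regular :: "('a::complex_algebra \<Rightarrow> complex) \<Rightarrow> bool" where
  "one_regular F \<longleftrightarrow> F \<in> dual_space \<and>
     (\<exists>U. open U \<and> F \<in> U \<and>
        (\<forall>G \<in> U \<inter> dual_space. complex_vector.dim (stab F) \<le> complex_vector.dim (stab G)))"

text \<open>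
  Only meaningful for finite-dimensional algebras, where \<^term>\<open>complex_vector.dim (stab F)\<close> is the
  same for all 1-regular \<^term>\<open>F\<close>, so that the choice is immaterial.
\<close>

definition alg_index :: "'a::complex_algebra itself \<Rightarrow> nat" where
  "alg_index _ = complex_vector.dim (stab (SOME F :: 'a \<Rightarrow> complex. one_regular F))"


section \<open>Matrix algebras\<close>

text \<open>
  A copy of the type of square matrices is needed because the multiplication \<open>*\<close> of the library
  type \<^typ>\<open>complex ^ 'n ^ 'n\<close> is the componentwise one.
\<close>

typedef 'n cmatrix = "UNIV :: (complex ^ 'n ^ 'n) set"
  morphisms matrix_of cmatrix_of ..

setup_lifting type_definition_cmatrix

instantiation cmatrix :: (finite) complex_algebra
begin

lift_definition zero_cmatrix :: "'a cmatrix" is 0 .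
lift_definition plus_cmatrix :: "'a cmatrix \<Rightarrow> 'a cmatrix \<Rightarrow> 'a cmatrix" is "(+)" .
lift_definition minus_cmatrix :: "'a cmatrix \<Rightarrow> 'a cmatrix \<Rightarrow> 'a cmatrix" is "(-)" .
lift_definition uminus_cmatrix :: "'a cmatrix \<Rightarrow> 'a cmatrix" is uminus .
lift_definition times_cmatrix :: "'a cmatrix \<Rightarrow> 'a cmatrix \<Rightarrow> 'a cmatrix" is "(**)" .
lift_definition scaleC_cmatrix :: "complex \<Rightarrow> 'a cmatrix \<Rightarrow> 'a cmatrix"
  is "\<lambda>c A. \<chi> i j. c * A $ i $ j" .

instance
  by (standard; transfer)
    (simp_all add: matrix_mul_assoc,
     simp_all add: vec_eq_iff matrix_matrix_mult_def sum_distrib_left sum.distrib algebra_simps)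

end


section \<open>Tensor products of algebras\<close>

instantiation poly_mapping :: (type, complex_vector) complex_vector
begin

lift_definition scaleC_poly_mapping :: "complex \<Rightarrow> ('a \<Rightarrow>\<^sub>0 'b) \<Rightarrow> 'a \<Rightarrow>\<^sub>0 'b"
  is "\<lambda>c f k. c *\<^sub>C f k"
  by (erule finite_subset[rotated]) auto

instance
  by (standard; transfer)
    (simp_all add: fun_eq_iff scaleC_add_right scaleC_add_left scaleC_scaleC scaleC_one)

end

text \<open>
  The type \<^typ>\<open>'a \<times> 'b \<Rightarrow>\<^sub>0 complex\<close> is the vector space freely generated by the pairs, with basis
  vectors \<open>gen a b\<close>.
\<close>

type_synonym ('a, 'b) free_pairs = "'a \<times> 'b \<Rightarrow>\<^sub>0 complex"

abbreviation gen :: "'a \<Rightarrow> 'b \<Rightarrow> ('a, 'b) free_pairs" where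
  "gen a b \<equiv> Poly_Mapping.single (a, b) 1"

definition tensor_relators :: "('a::complex_vector, 'b::complex_vector) free_pairs set" where
  "tensor_relators =
     {gen (a + a') b - gen a b - gen a' b | a a' b. True} \<union>
     {gen a (b + b') - gen a b - gen a b' | a b b'. True} \<union>
     {gen (c *\<^sub>C a) b - c *\<^sub>C gen a b | c a b. True} \<union>
     {gen a (c *\<^sub>C b) - c *\<^sub>C gen a b | c a b. True}"

definition tensor_rel ::
  "('a::complex_vector, 'b::complex_vector) free_pairs \<Rightarrow> ('a, 'b) free_pairs \<Rightarrow> bool" where
  "tensor_rel x y \<longleftrightarrow> x - y \<in> complex_vector.span tensor_relators"

lemma tensor_rel_equivp: "equivp tensor_rel"
proof (rule equivpI)
  show "reflp tensor_rel"
    by (simp add: reflp_def tensor_rel_def complex_vector.span_zero)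
  show "symp tensor_rel"
    unfolding symp_def tensor_rel_def
    using complex_vector.span_neg by fastforce
  show "transp tensor_rel"
    unfolding transp_def tensor_rel_def
    using complex_vector.span_add by fastforce
qed

quotient_type (overloaded) ('a, 'b) tensor (infixr "\<otimes>" 25) =
    "('a::complex_vector, 'b::complex_vector) free_pairs" / tensor_rel
  by (rule tensor_rel_equivp)

lift_definition pure_tensor :: "'a::complex_vector \<Rightarrow> 'b::complex_vector \<Rightarrow> 'a \<otimes> 'b" is gen .

instantiation tensor :: (complex_vector, complex_vector) complex_vector
begin

lift_definition zero_tensor :: "'a \<otimes> 'b" is 0 .

lift_definition plus_tensor :: "'a \<otimes> 'b \<Rightarrow> 'a \<otimes> 'b \<Rightarrow> 'a \<otimes> 'b" is "(+)"
  unfolding tensor_rel_def by (metis complex_vector.span_add add_diff_add)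

lift_definition minus_tensor :: "'a \<otimes> 'b \<Rightarrow> 'a \<otimes> 'b \<Rightarrow> 'a \<otimes> 'b" is "(-)"
proof -
  fix x x' y y' :: "('a, 'b) free_pairs"
  assume "tensor_rel x x'" "tensor_rel y y'"
  moreover have "(x - y) - (x' - y') = (x - x') - (y - y')" by simp
  ultimately show "tensor_rel (x - y) (x' - y')"
    unfolding tensor_rel_def by (metis complex_vector.span_diff)
qed

lift_definition uminus_tensor :: "'a \<otimes> 'b \<Rightarrow> 'a \<otimes> 'b" is uminus
  unfolding tensor_rel_def by (metis complex_vector.span_neg minus_diff_minus)

lift_definition scaleC_tensor :: "complex \<Rightarrow> 'a \<otimes> 'b \<Rightarrow> 'a \<otimes> 'b" is scaleC
  unfolding tensor_rel_def
  by (metis complex_vector.span_scale complex_vector.scale_right_diff_distrib)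

instance
  by (standard; transfer)
    (simp_all add: algebra_simps scaleC_add_right scaleC_add_left scaleC_scaleC scaleC_one
      equivp_reflp[OF tensor_rel_equivp])

end

text \<open>
  The product on the free space is the bilinear extension of
  \<open>(gen a b, gen c d) \<mapsto> gen (a * c) (b * d)\<close>.
\<close>

definition free_times ::
  "('a::times, 'b::times) free_pairs \<Rightarrow> ('a, 'b) free_pairs \<Rightarrow> ('a, 'b) free_pairs" where
  "free_times x y =
     (\<Sum>p\<in>Poly_Mapping.keys x. \<Sum>q\<in>Poly_Mapping.keys y.
        (Poly_Mapping.lookup x p * Poly_Mapping.lookup y q) *\<^sub>C gen (fst p * fst q) (snd p * snd q))"

lemma free_times_superset:
  assumes "finite S" "finite T" "Poly_Mapping.keys x \<subseteq> S" "Poly_Mapping.keys y \<subseteq> T"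
  shows "free_times x y = (\<Sum>p\<in>S. \<Sum>q\<in>T.
    (Poly_Mapping.lookup x p * Poly_Mapping.lookup y q) *\<^sub>C gen (fst p * fst q) (snd p * snd q))"
proof -
  have "free_times x y = (\<Sum>p\<in>Poly_Mapping.keys x. \<Sum>q\<in>T.
    (Poly_Mapping.lookup x p * Poly_Mapping.lookup y q) *\<^sub>C gen (fst p * fst q) (snd p * snd q))"
    unfolding free_times_def using assms
    by (intro sum.cong sum.mono_neutral_left) (auto simp: in_keys_iff)
  also have "\<dots> = (\<Sum>p\<in>S. \<Sum>q\<in>T.
    (Poly_Mapping.lookup x p * Poly_Mapping.lookup y q) *\<^sub>C gen (fst p * fst q) (snd p * snd q))"
    using assms by (intro sum.mono_neutral_left) (auto simp: in_keys_iff)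
  finally show ?thesis .
qed

lemma lookup_scaleC: "Poly_Mapping.lookup (c *\<^sub>C x) k = c *\<^sub>C Poly_Mapping.lookup x k"
  by transfer simp

lemma free_times_add_left: "free_times (x + x') y = free_times x y + free_times x' y"
  using free_times_superset[of "Poly_Mapping.keys x \<union> Poly_Mapping.keys x'" "Poly_Mapping.keys y"]
  by (simp add: Poly_Mapping.keys_add lookup_add scaleC_add_left distrib_right sum.distrib)

lemma free_times_add_right: "free_times x (y + y') = free_times x y + free_times x y'"
  using free_times_superset[of "Poly_Mapping.keys x" "Poly_Mapping.keys y \<union> Poly_Mapping.keys y'"]
  by (simp add: Poly_Mapping.keys_add lookup_add scaleC_add_left distrib_left sum.distrib)

lemma keys_scaleC: "Poly_Mapping.keys (c *\<^sub>C x) \<subseteq> Poly_Mapping.keys x"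
  by (auto simp: in_keys_iff lookup_scaleC)

lemma free_times_scale_left: "free_times (c *\<^sub>C x) y = c *\<^sub>C free_times x y"
  using free_times_superset[of "Poly_Mapping.keys x" "Poly_Mapping.keys y" "c *\<^sub>C x" y]
  by (simp add: keys_scaleC lookup_scaleC scaleC_complex_def free_times_def
      complex_vector.scale_sum_right mult.assoc)

lemma free_times_scale_right: "free_times x (c *\<^sub>C y) = c *\<^sub>C free_times x y"
  using free_times_superset[of "Poly_Mapping.keys x" "Poly_Mapping.keys y" x "c *\<^sub>C y"]
  by (simp add: keys_scaleC lookup_scaleC scaleC_complex_def free_times_def
      complex_vector.scale_sum_right mult_ac)

lemma free_times_diff_left: "free_times (x - x') y = free_times x y - free_times x' y"
  using free_times_add_left[of "x - x'" x' y] by (simp add: algebra_simps)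

lemma free_times_diff_right: "free_times x (y - y') = free_times x y - free_times x y'"
  using free_times_add_right[of x "y - y'" y'] by (simp add: algebra_simps)

lemma free_times_gen: "free_times (gen a b) (gen c d) = gen (a * c) (b * d)"
  by (simp add: free_times_def scaleC_one)

lemma free_times_zero: "free_times 0 y = 0" "free_times x 0 = 0"
  by (simp_all add: free_times_def)

lemma free_pairs_induct [case_names zero add scale gen]:
  fixes x :: "('a, 'b) free_pairs"
  assumes "P 0" "\<And>x y. P x \<Longrightarrow> P y \<Longrightarrow> P (x + y)" "\<And>c x. P x \<Longrightarrow> P (c *\<^sub>C x)" "\<And>a b. P (gen a b)"
  shows "P x"
proof (induction x rule: Poly_Mapping.update_induct)
  case (update f k v)
  then have "Poly_Mapping.update k v f = f + v *\<^sub>C gen (fst k) (snd k)"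
    by (intro poly_mapping_eqI) (auto simp: lookup_scaleC lookup_single lookup_add lookup_update
        scaleC_complex_def when_def in_keys_iff)
  then show ?case
    using assms(2)[OF update.IH assms(3)[OF assms(4)]] by metis
qed (fact assms(1))

lemma free_times_assoc:
  fixes x y z :: "('a::semigroup_mult, 'b::semigroup_mult) free_pairs"
  shows "free_times (free_times x y) z = free_times x (free_times y z)"
proof (induction x rule: free_pairs_induct)
  case (gen a b)
  show ?case
  proof (induction y rule: free_pairs_induct)
    case (gen c d)
    show ?case
      by (induction z rule: free_pairs_induct)
        (simp_all add: free_times_zero free_times_add_right free_times_scale_right
          free_times_gen mult.assoc)
  qed (simp_all add: free_times_zero free_times_add_right free_times_add_left
      free_times_scale_right free_times_scale_left)
qed (simp_all add: free_times_zero free_times_add_left free_times_scale_left)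

lemma free_times_relator:
  fixes r y :: "('a::complex_algebra, 'b::complex_algebra) free_pairs"
  assumes "r \<in> tensor_relators"
  shows "free_times r y \<in> complex_vector.span tensor_relators"
    and "free_times y r \<in> complex_vector.span tensor_relators"
proof -
  have "free_times r (gen c d) \<in> tensor_relators \<and> free_times (gen c d) r \<in> tensor_relators" for c d
    using assms unfolding tensor_relators_def
    by (elim UnE CollectE exE)
      (simp_all only: free_times_diff_left free_times_diff_right free_times_scale_left
        free_times_scale_right free_times_gen distrib_left distrib_right mult_scaleC_left
        mult_scaleC_right, blast+)
  note * = this
  show "free_times r y \<in> complex_vector.span tensor_relators"
    by (induction y rule: free_pairs_induct)
      (simp_all add: * free_times_zero free_times_add_right free_times_scale_right
        complex_vector.span_zero complex_vector.span_add complex_vector.span_scale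
        complex_vector.span_base)
  show "free_times y r \<in> complex_vector.span tensor_relators"
    by (induction y rule: free_pairs_induct)
      (simp_all add: * free_times_zero free_times_add_left free_times_scale_left
        complex_vector.span_zero complex_vector.span_add complex_vector.span_scale
        complex_vector.span_base)
qed

lemma free_times_span_relators:
  fixes r y :: "('a::complex_algebra, 'b::complex_algebra) free_pairs"
  assumes "r \<in> complex_vector.span tensor_relators"
  shows "free_times r y \<in> complex_vector.span tensor_relators"
    and "free_times y r \<in> complex_vector.span tensor_relators"
proof -
  show "free_times r y \<in> complex_vector.span tensor_relators"
    using assms by (induction rule: complex_vector.span_induct_alt)
      (simp_all add: free_times_relator free_times_zero free_times_add_left free_times_scale_left
        complex_vector.span_zero complex_vector.span_add complex_vector.span_scale)
  show "free_times y r \<in> complex_vector.span tensor_relators"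
    using assms by (induction rule: complex_vector.span_induct_alt)
      (simp_all add: free_times_relator free_times_zero free_times_add_right free_times_scale_right
        complex_vector.span_zero complex_vector.span_add complex_vector.span_scale)
qed

instantiation tensor :: (complex_algebra, complex_algebra) complex_algebra
begin

lift_definition times_tensor :: "'a \<otimes> 'b \<Rightarrow> 'a \<otimes> 'b \<Rightarrow> 'a \<otimes> 'b" is free_times
proof -
  fix x x' y y' :: "('a, 'b) free_pairs"
  assume "tensor_rel x x'" "tensor_rel y y'"
  moreover have "free_times x y - free_times x' y' =
      free_times (x - x') y + free_times x' (y - y')"
    by (simp add: free_times_diff_left free_times_diff_right)
  ultimately show "tensor_rel (free_times x y) (free_times x' y')"
    unfolding tensor_rel_def by (simp add: complex_vector.span_add free_times_span_relators)
qed

instance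
  by (standard; transfer)
    (simp_all add: free_times_assoc free_times_add_left free_times_add_right free_times_scale_left
      free_times_scale_right equivp_reflp[OF tensor_rel_equivp])

end

lemma pure_tensor_mult: "pure_tensor a b * pure_tensor c d = pure_tensor (a * c) (b * d)"
  by transfer (simp add: free_times_gen equivp_reflp[OF tensor_rel_equivp])

end

theory Submission
  imports Defs
    "Jordan_Normal_Form.Determinant"
    "HOL-Computational_Algebra.Fundamental_Theorem_Algebra"
begin

text \<open>
  Besides the stabiliser of a functional \<open>F\<close>, consider for a complex number \<open>c\<close>, the twist, the
  twisted stabiliser of all \<open>a\<close> with \<open>F (a * x) = c * F (x * a)\<close> for all \<open>x\<close>.  Twists multiply under the product of the
  algebra.  The twists with nonzero stabiliser, called nontrivial, are the singular parameters of a
  pencil of matrices, so they are the roots of a polynomial.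

  Let \<open>B\<close> have index one.  Then there is a functional \<open>F\<close> whose stabiliser consists of the scalars and
  with \<open>F 1 \<noteq> 0\<close> (\<open>stab_scalar_functional_exists\<close>), and this normalisation implies that only finitely
  many twists of \<open>F\<close> are nontrivial (\<open>finite_nontrivial_stab_at_scalar\<close>).  On matrices over \<open>B\<close> take
  \<open>G X = (\<Sum>i. t\<^sub>i * F X\<^sub>i\<^sub>i)\<close>.  An entry \<open>X\<^sub>k\<^sub>l\<close> of an element of the \<open>c\<close>-twisted stabiliser of \<open>G\<close> lies in
  the twisted stabiliser of \<open>F\<close> for \<open>c * t\<^sub>l / t\<^sub>k\<close>.  For weights \<open>t\<close> whose ratios avoid the finitely
  many nontrivial twists of \<open>F\<close>, the stabiliser of \<open>G\<close> is the space of scalar diagonal matrices, of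
  dimension \<open>n\<close>; hence the
  index is at most \<open>n\<close>.

  For the lower bound, the stabilisers of functionals \<open>H\<close> close to \<open>G\<close> must not be smaller.  With
  generic weights and \<open>i \<noteq> j\<close>, the stabiliser of \<open>G\<close> with twist \<open>t\<^sub>i / t\<^sub>j\<close> is the line through the matrix unit
  \<open>e\<^sub>i\<^sub>j\<close>.  Roots of polynomials move continuously, so \<open>H\<close> has a nontrivial twist \<open>c\<close> close to
  \<open>t\<^sub>i / t\<^sub>j\<close>, and by transposition also the twist \<open>1 / c\<close>.  By compactness, elements for these twists
  can be chosen close to \<open>e\<^sub>i\<^sub>j\<close> and \<open>e\<^sub>j\<^sub>i\<close>.  Their product has twist exactly \<open>1\<close>: it stabilises \<open>H\<close>, and
  it is close to \<open>e\<^sub>i\<^sub>i\<close> (\<open>approximate_stabiliser\<close>).  For \<open>i\<close> ranging over all indices this gives \<open>n\<close>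
  linearly independent elements of the stabiliser of \<open>H\<close>.

  Finally, the dimension of the stabiliser is generically constant and minimal on every line of
  functionals (\<open>dim_stab_pencil\<close>).  So a local minimum is a global one, and the two bounds, obtained at
  \<open>G\<close> and near \<open>G\<close>, determine the index.
\<close>

section \<open>Determinants of pencils and continuity of roots\<close>

text \<open>
  The index set is an initial segment of the natural numbers because the dimension of the algebra is
  not available as a type.  In the applications \<open>a i j\<close> is the value of a bilinear form on the
  \<open>i\<close>-th and \<open>j\<close>-th vector of a basis of the algebra or of a subspace.
\<close>

definition gram_det :: "nat \<Rightarrow> (nat \<Rightarrow> nat \<Rightarrow> complex) \<Rightarrow> complex" where
  "gram_det r a = det (mat r r (\<lambda>(i, j). a i j))"

lemma gram_det_transpose: "gram_det r (\<lambda>i j. a j i) = gram_det r a"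
proof -
  have "mat r r (\<lambda>(i, j). a j i) = transpose_mat (mat r r (\<lambda>(i, j). a i j))"
    by (intro eq_matI) auto
  then show ?thesis
    unfolding gram_det_def by (simp add: det_transpose[of _ r])
qed

lemma gram_det_eq_0_iff:
  "gram_det r a = 0 \<longleftrightarrow> (\<exists>v. (\<exists>i<r. v i \<noteq> 0) \<and> (\<forall>j<r. (\<Sum>i<r. v i * a i j) = 0))"
proof -
  let ?M = "mat r r (\<lambda>(i, j). a j i)"
  have entry: "vec_index (?M *\<^sub>v v) j = (\<Sum>i<r. vec_index v i * a i j)" if "v \<in> carrier_vec r" "j < r" for v j
    using that by (simp add: scalar_prod_def lessThan_atLeast0 mult.commute)
  have "gram_det r a = 0 \<longleftrightarrow> (\<exists>v. v \<in> carrier_vec r \<and> v \<noteq> 0\<^sub>v r \<and> ?M *\<^sub>v v = 0\<^sub>v r)"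
    using det_0_iff_vec_prod_zero_field[of ?M r] gram_det_transpose[of r a]
    by (simp add: gram_det_def)
  also have "\<dots> \<longleftrightarrow> (\<exists>v. (\<exists>i<r. v i \<noteq> 0) \<and> (\<forall>j<r. (\<Sum>i<r. v i * a i j) = 0))" (is "?L \<longleftrightarrow> ?R")
  proof
    assume ?L
    then obtain v where v: "v \<in> carrier_vec r" "v \<noteq> 0\<^sub>v r" "?M *\<^sub>v v = 0\<^sub>v r" by blast
    have "\<exists>i<r. vec_index v i \<noteq> 0"
      using v(1,2) by (auto simp: vec_eq_iff)
    moreover have "(\<Sum>i<r. vec_index v i * a i j) = 0" if "j < r" for j
      using entry[OF v(1) that] v(3) that by simp
    ultimately show ?R by blast
  next
    assume ?R
    then obtain v where v: "\<exists>i<r. v i \<noteq> 0" "\<forall>j<r. (\<Sum>i<r. v i * a i j) = 0" by blast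
    have "?M *\<^sub>v vec r v = 0\<^sub>v r"
      using v(2) entry[of "vec r v"] by (intro eq_vecI) auto
    moreover have "vec r v \<noteq> 0\<^sub>v r"
      using v(1) by (auto simp: vec_eq_iff)
    ultimately show ?L using vec_carrier[of r v] by blast
  qed
  finally show ?thesis .
qed

lemma gram_det_scale_eq_0:
  assumes "k \<noteq> 0"
  shows "gram_det r (\<lambda>i j. k * a i j) = 0 \<longleftrightarrow> gram_det r a = 0"
proof -
  have "(\<Sum>i<r. v i * (k * a i j)) = k * (\<Sum>i<r. v i * a i j)" for v j
    by (simp add: sum_distrib_left mult_ac)
  then show ?thesis
    unfolding gram_det_eq_0_iff using assms by simp
qed

text \<open>
  The degree bound does not depend on the forms \<open>a\<close> and \<open>b\<close>.  The lower bound for polynomials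
  without roots in a disc depends on the degree only, so it then holds uniformly along a sequence of
  pencils.
\<close>

lemma gram_det_pencil_poly:
  obtains p :: "complex poly"
  where "degree p \<le> r" "\<And>t. poly p t = gram_det r (\<lambda>i j. a i j + t * b i j)"
proof
  let ?M = "mat r r (\<lambda>(i, j). [:a i j, b i j:])"
  show "degree (det ?M) \<le> r"
    using degree_det_le[of r ?M 1] by simp
  show "poly (det ?M) t = gram_det r (\<lambda>i j. a i j + t * b i j)" for t
  proof -
    interpret comm_ring_hom "\<lambda>p. poly p t" by unfold_locales auto
    have "map_mat (\<lambda>p. poly p t) ?M = mat r r (\<lambda>(i, j). a i j + t * b i j)"
      by (intro eq_matI) auto
    then show ?thesis
      unfolding gram_det_def using hom_det[of ?M] by simp
  qed
qed

lemma tendsto_gram_det: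
  assumes "\<And>i j. i < r \<Longrightarrow> j < r \<Longrightarrow> ((\<lambda>k. a k i j) \<longlongrightarrow> b i j) net"
  shows "((\<lambda>k. gram_det r (a k)) \<longlongrightarrow> gram_det r b) net"
proof -
  have permutes_nat_less: "p i < r" if "p permutes {0..<r}" "i < r" for p i
    using permutes_in_image[OF that(1), of i] that(2) by simp
  have eq: "gram_det r c = (\<Sum>p\<in>{p. p permutes {0..<r}}. signof p * (\<Prod>i=0..<r. c i (p i)))" for c
    unfolding gram_det_def
    by (subst det_def'[of _ r]) (auto intro!: sum.cong prod.cong simp: permutes_nat_less)
  show ?thesis
    unfolding eq by (intro tendsto_intros assms) (auto simp: permutes_nat_less)
qed

text \<open>
  A quantitative form of the continuity of roots.  A root \<open>w\<close> has distance at least \<open>r\<close> from the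
  centre \<open>c\<close>, so moving from \<open>c\<close> to a point \<open>d\<close> at distance at most \<open>r / 2\<close> multiplies the
  distance to \<open>w\<close> by at most \<open>3 / 2\<close>; the factors of the polynomial multiply up.
\<close>

lemma root_free_disc_lower_bound:
  fixes p :: "complex poly"
  assumes "degree p \<le> m" "\<And>z. dist z c < r \<Longrightarrow> poly p z \<noteq> 0" "dist d c \<le> r / 2" "r > 0"
  shows "(2 / 3) ^ m * norm (poly p d) \<le> norm (poly p c)"
  using assms(1,2)
proof (induction m arbitrary: p)
  case 0
  then obtain a where "p = [:a:]"
    by (auto elim: degree_eq_zeroE)
  then show ?case by simp
next
  case (Suc m)
  show ?case
  proof (cases "degree p = 0")
    case True
    then obtain a where "p = [:a:]"
      by (auto elim: degree_eq_zeroE)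
    moreover have "(2 / 3 :: real) ^ Suc m * norm a \<le> norm a"
      by (rule mult_left_le_one_le) (auto intro!: power_le_one simp del: power_Suc)
    ultimately show ?thesis
      by (simp only: poly_pCons poly_0 mult_zero_right add_0_right)
  next
    case False
    then obtain w where w: "poly p w = 0"
      by (metis fundamental_theorem_of_algebra constant_degree)
    then obtain q where q: "p = [:-w, 1:] * q"
      using w unfolding poly_eq_0_iff_dvd by (elim dvdE)
    have "q \<noteq> 0" using False q by auto
    then have "degree q \<le> m"
      using Suc.prems(1) unfolding q by (subst (asm) degree_mult_eq) auto
    moreover have "poly q z \<noteq> 0" if "dist z c < r" for z
      using Suc.prems(2)[OF that] unfolding q by auto
    ultimately have IH: "(2 / 3) ^ m * norm (poly q d) \<le> norm (poly q c)"
      by (rule Suc.IH)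
    have far: "r \<le> dist w c"
      using Suc.prems(2) w by (meson not_le)
    have "dist d w \<le> dist d c + dist w c"
      by (metis dist_commute dist_triangle)
    then have "2 / 3 * norm (d - w) \<le> norm (c - w)"
      using far assms(3) by (simp add: dist_norm norm_minus_commute)
    then have "(2 / 3 * norm (d - w)) * ((2 / 3) ^ m * norm (poly q d)) \<le> norm (c - w) * norm (poly q c)"
      using IH by (intro mult_mono) auto
    moreover have "poly p z = (z - w) * poly q z" for z
      unfolding q by (simp add: algebra_simps)
    ultimately show ?thesis
      by (simp add: norm_mult mult_ac)
  qed
qed

section \<open>Functionals and coordinates in finite dimension\<close>

lemma dual_space_iff:
  "F \<in> dual_space \<longleftrightarrow> (\<forall>x y. F (x + y) = F x + F y) \<and> (\<forall>c x. F (c *\<^sub>C x) = c * F x)"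
proof -
  have "vector_space ((*\<^sub>C) :: complex \<Rightarrow> 'a \<Rightarrow> 'a)" "vector_space ((*\<^sub>C) :: complex \<Rightarrow> complex \<Rightarrow> complex)"
    by unfold_locales
  then show ?thesis
    unfolding dual_space_def Vector_Spaces.linear_iff by (simp add: scaleC_complex_def)
qed

lemma dual_add: "F \<in> dual_space \<Longrightarrow> F (x + y) = F x + F y"
  and dual_scale: "F \<in> dual_space \<Longrightarrow> F (c *\<^sub>C x) = c * F x"
  by (auto simp: dual_space_iff)

lemma dual_zero: "F \<in> dual_space \<Longrightarrow> F 0 = 0"
  using dual_add[of F 0 0] by simp

lemma dual_sum: "F \<in> dual_space \<Longrightarrow> F (\<Sum>i\<in>I. g i) = (\<Sum>i\<in>I. F (g i))"
  by (induction I rule: infinite_finite_induct) (auto simp: dual_add dual_zero)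

lemma dual_combination:
  "F \<in> dual_space \<Longrightarrow> K \<in> dual_space \<Longrightarrow> (\<lambda>x. a * F x + b * K x) \<in> dual_space"
  by (auto simp: dual_space_iff algebra_simps)

text \<open>
  A basis and its dual basis.  Numbering the basis vectors is what makes determinants of bilinear forms
  on the space available.
\<close>

locale coordinates =
  fixes m :: nat and e :: "nat \<Rightarrow> 'a::complex_vector" and co :: "nat \<Rightarrow> 'a \<Rightarrow> complex"
  assumes expand: "(\<Sum>i<m. co i x *\<^sub>C e i) = x"
    and co_dual: "i < m \<Longrightarrow> co i \<in> dual_space"
    and co_basis: "i < m \<Longrightarrow> j < m \<Longrightarrow> co i (e j) = (if i = j then 1 else 0)"

lemma finite_basis_exists:
  assumes "finite_dim TYPE('a::complex_vector)"
  obtains B :: "'a::complex_vector set" where "finite B" "complex_vector.independent B" "complex_vector.span B = UNIV"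
proof -
  obtain S :: "'a set" where S: "finite S" "complex_vector.span S = UNIV"
    using assms unfolding finite_dim_def by blast
  obtain B where "B \<subseteq> S" "complex_vector.independent B" "S \<subseteq> complex_vector.span B"
    using complex_vector.maximal_independent_subset[of S] by blast
  then show ?thesis
    using that[of B] S by (metis complex_vector.span_minimal complex_vector.subspace_span finite_subset top.extremum_uniqueI)
qed

lemma coordinates_exist:
  assumes "finite_dim TYPE('a::complex_vector)"
  obtains m and e :: "nat \<Rightarrow> 'a::complex_vector" and co where "coordinates m e co"
proof -
  obtain B :: "'a set" where B: "finite B" "complex_vector.independent B" "complex_vector.span B = UNIV"
    using finite_basis_exists[OF assms] .
  obtain e where e: "bij_betw e {..<card B} B"
    using ex_bij_betw_nat_finite[OF B(1)] by (auto simp: lessThan_atLeast0)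
  define co where "co = (\<lambda>i x. complex_vector.representation B x (e i))"
  have "coordinates (card B) e co"
  proof
    show "(\<Sum>i<card B. co i x *\<^sub>C e i) = x" for x
      unfolding co_def
      using sum.reindex_bij_betw[OF e, of "\<lambda>b. complex_vector.representation B x b *\<^sub>C b"]
        complex_vector.sum_representation_eq[OF B(2) _ B(1) subset_refl, of x] B(3) by simp
    show "co i \<in> dual_space" if "i < card B" for i
      unfolding co_def dual_space_iff using B(2,3)
      by (simp add: complex_vector.representation_add complex_vector.representation_scale)
    show "co i (e j) = (if i = j then 1 else 0)" if "i < card B" "j < card B" for i j
      using that e bij_betwE[OF e] unfolding co_def
      by (auto simp: complex_vector.representation_basis[OF B(2)] bij_betw_def inj_on_def)
  qed
  then show ?thesis by (rule that)
qed

section \<open>Twisted stabilisers\<close>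

text \<open>
  The stabiliser \<open>Stab\<^sub>F(c)\<close> with a twist \<open>c\<close>.  It is the left kernel of the member with parameter
  \<open>c\<close> of the pencil spanned by the bilinear form \<open>(x, y) \<mapsto> F (x * y)\<close> and its transpose.
\<close>

definition stab_at :: "('a::complex_algebra \<Rightarrow> complex) \<Rightarrow> complex \<Rightarrow> 'a set" where
  "stab_at F c = {a. \<forall>x. F (a * x) = c * F (x * a)}"

lemma stab_eq_stab_at: "stab F = stab_at F 1"
  by (simp add: stab_def stab_at_def)

lemma stab_at_subspace: "F \<in> dual_space \<Longrightarrow> complex_vector.subspace (stab_at F c)"
  by (auto simp: complex_vector.subspace_def stab_at_def dual_zero distrib_left distrib_right dual_add
      mult_scaleC_left mult_scaleC_right dual_scale)

lemma zero_in_stab_at: "F \<in> dual_space \<Longrightarrow> 0 \<in> stab_at F c"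
  by (simp add: stab_at_def dual_zero)

text \<open>
  Twists multiply.  This is how elements of the stabiliser itself are produced below: as products of
  an element with twist \<open>c\<close> and one with twist \<open>1 / c\<close>.
\<close>

lemma stab_at_mult:
  assumes "a \<in> stab_at F c" "b \<in> stab_at F d"
  shows "a * b \<in> stab_at F (c * d)"
proof -
  have "F (a * b * x) = c * d * F (x * (a * b))" for x
  proof -
    have "F (a * b * x) = c * F (b * (x * a))"
      using assms(1) by (simp add: stab_at_def mult.assoc)
    also have "\<dots> = c * (d * F (x * a * b))"
      using assms(2) by (simp add: stab_at_def)
    finally show ?thesis by (simp add: mult.assoc)
  qed
  then show ?thesis by (simp add: stab_at_def)
qed

section \<open>Weak convergence and compactness\<close>

text \<open>
  In finite dimension this is the usual convergence.  Testing against functionals makes it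
  independent of a basis, and no norm has to be put on the abstract algebra.
\<close>

definition weakly_tendsto :: "(nat \<Rightarrow> 'a::complex_vector) \<Rightarrow> 'a \<Rightarrow> bool" where
  "weakly_tendsto x a \<longleftrightarrow> (\<forall>F\<in>dual_space. (\<lambda>k. F (x k)) \<longlonglongrightarrow> F a)"

lemma weakly_tendstoD: "weakly_tendsto x a \<Longrightarrow> F \<in> dual_space \<Longrightarrow> (\<lambda>k. F (x k)) \<longlonglongrightarrow> F a"
  by (simp add: weakly_tendsto_def)

lemma weakly_tendsto_subseq:
  "weakly_tendsto x a \<Longrightarrow> strict_mono r \<Longrightarrow> weakly_tendsto (\<lambda>k. x (r k)) a"
  unfolding weakly_tendsto_def using LIMSEQ_subseq_LIMSEQ[of _ _ r] by (auto simp: o_def)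

context coordinates
begin

lemma dual_expand: "F \<in> dual_space \<Longrightarrow> F x = (\<Sum>i<m. co i x * F (e i))"
  using arg_cong[OF expand[of x], of F] by (simp add: dual_sum dual_scale)

lemma co_combination: "j < m \<Longrightarrow> co j (\<Sum>i<m. v i *\<^sub>C e i) = v j"
  by (simp add: dual_sum dual_scale co_dual co_basis if_distrib cong: if_cong)

lemma coordinate_nonzero: "x \<noteq> 0 \<Longrightarrow> \<exists>i<m. co i x \<noteq> 0"
  using expand[of x] by (auto intro: ccontr)

lemma tendsto_functionals:
  fixes x :: "nat \<Rightarrow> 'a"
  assumes H: "\<And>k. H k \<in> dual_space" "G \<in> dual_space" "\<And>x. (\<lambda>k. H k x) \<longlonglongrightarrow> G x"
    and x: "weakly_tendsto x a"
  shows "(\<lambda>k. H k (x k)) \<longlonglongrightarrow> G a"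
proof -
  have "(\<lambda>k. \<Sum>i<m. co i (x k) * H k (e i)) \<longlonglongrightarrow> (\<Sum>i<m. co i a * G (e i))"
    using H(3) x co_dual by (intro tendsto_intros) (auto simp: weakly_tendsto_def)
  moreover have "H k (x k) = (\<Sum>i<m. co i (x k) * H k (e i))" for k
    by (rule dual_expand[OF H(1)])
  ultimately show ?thesis
    using dual_expand[OF H(2), of a] by (simp only:)
qed

text \<open>
  Compactness of the unit sphere, with the scalars \<open>c\<close> normalising the vectors.
\<close>

lemma limit_of_nonzero_vectors:
  fixes x :: "nat \<Rightarrow> 'a"
  assumes "\<And>k. x k \<noteq> 0"
  obtains r c a where "strict_mono r" "\<And>k. c k \<noteq> 0" "a \<noteq> 0" "weakly_tendsto (\<lambda>k. c k *\<^sub>C x (r k)) a"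
proof -
  define N where "N = (\<lambda>k. \<Sum>i<m. norm (co i (x k)))"
  have N: "N k > 0" for k
  proof -
    obtain i where i: "i < m" "co i (x k) \<noteq> 0"
      using coordinate_nonzero[OF assms] by blast
    have "norm (co i (x k)) \<le> N k"
      unfolding N_def using i by (intro member_le_sum) auto
    then show ?thesis using i by (meson order_less_le_trans zero_less_norm_iff)
  qed
  \<comment> \<open>Normalising the sum of the absolute values of the coordinates is preserved by coordinatewise
    limits, which keeps the limit vector away from zero.\<close>
  define y where "y = (\<lambda>k. complex_of_real (1 / N k) *\<^sub>C x k)"
  have y1: "(\<Sum>i<m. norm (co i (y k))) = 1" for k
  proof -
    have "(\<Sum>i<m. norm (co i (y k))) = (\<Sum>i<m. norm (co i (x k)) / N k)"
      using N[of k] by (intro sum.cong) (auto simp: y_def dual_scale co_dual norm_divide)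
    also have "\<dots> = N k / N k"
      unfolding N_def by (simp flip: sum_divide_distrib)
    finally show ?thesis using N[of k] by simp
  qed
  have le1: "norm (co i (y k)) \<le> 1" if "i < m" for i k
    using y1[of k] member_le_sum[of i "{..<m}" "\<lambda>i. norm (co i (y k))"] that by auto
  have subseq: "\<exists>r. strict_mono r \<and> (\<forall>i<n. convergent (\<lambda>k. co i (y (r k))))" if "n \<le> m" for n
    using that
  proof (induction n)
    case 0
    show ?case using strict_mono_id by auto
  next
    case (Suc n)
    then obtain r where r: "strict_mono r" "\<forall>i<n. convergent (\<lambda>k. co i (y (r k)))" by auto
    have "bounded (range (\<lambda>k. co n (y (r k))))"
      using le1[of n] Suc.prems by (auto simp: bounded_iff)
    then obtain l r' where r': "strict_mono r'" "(\<lambda>k. co n (y (r (r' k)))) \<longlonglongrightarrow> l"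
      using bounded_imp_convergent_subsequence[of "\<lambda>k. co n (y (r k))"] by (auto simp: o_def)
    have "convergent (\<lambda>k. co i (y (r (r' k))))" if "i < Suc n" for i
    proof (cases "i = n")
      case True
      then show ?thesis using r'(2) by (auto simp: convergent_def)
    next
      case False
      then show ?thesis
        using r(2) that convergent_subseq_convergent[OF _ r'(1), of "\<lambda>k. co i (y (r k))"]
        by (auto simp: o_def)
    qed
    then have "\<forall>i<Suc n. convergent (\<lambda>k. co i (y ((r \<circ> r') k)))"
      unfolding o_apply by blast
    moreover have "strict_mono (r \<circ> r')"
      using r(1) r'(1) by (rule strict_mono_o)
    ultimately show ?case
      by (intro exI[of _ "r \<circ> r'"] conjI)
  qed
  obtain r where r: "strict_mono r" "\<And>i. i < m \<Longrightarrow> convergent (\<lambda>k. co i (y (r k)))"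
    using subseq[of m] by blast
  define v where "v = (\<lambda>i. lim (\<lambda>k. co i (y (r k))))"
  have v: "(\<lambda>k. co i (y (r k))) \<longlonglongrightarrow> v i" if "i < m" for i
    using r(2)[OF that] unfolding v_def convergent_LIMSEQ_iff .
  define a where "a = (\<Sum>i<m. v i *\<^sub>C e i)"
  have "(\<lambda>k. \<Sum>i<m. norm (co i (y (r k)))) \<longlonglongrightarrow> (\<Sum>i<m. norm (v i))"
    by (intro tendsto_intros v) simp
  then have "(\<Sum>i<m. norm (v i)) = 1"
    unfolding y1 by (simp only: LIMSEQ_const_iff)
  moreover have "(\<Sum>i<m. norm (v i)) = 0" if "a = 0"
  proof (intro sum.neutral ballI)
    fix i assume "i \<in> {..<m}"
    then show "norm (v i) = 0"
      using co_combination[of i v] dual_zero[OF co_dual, of i] that by (simp add: a_def)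
  qed
  ultimately have "a \<noteq> 0" by auto
  moreover have "weakly_tendsto (\<lambda>k. y (r k)) a"
    unfolding weakly_tendsto_def
  proof
    fix F :: "'a \<Rightarrow> complex"
    assume F: "F \<in> dual_space"
    have "(\<lambda>k. \<Sum>i<m. co i (y (r k)) * F (e i)) \<longlonglongrightarrow> (\<Sum>i<m. co i a * F (e i))"
      using v by (intro tendsto_intros) (auto simp: a_def co_combination)
    then show "(\<lambda>k. F (y (r k))) \<longlonglongrightarrow> F a"
      unfolding dual_expand[OF F, symmetric] .
  qed
  moreover have "complex_of_real (1 / N (r k)) \<noteq> 0" for k
    using N[of "r k"] by simp
  ultimately show ?thesis
    using that[of r "\<lambda>k. complex_of_real (1 / N (r k))" a] r(1) unfolding y_def by blast
qed

end

section \<open>Twisted stabilisers under perturbation of the functional\<close>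

text \<open>
  The expression on the right is affine in the twist \<open>c\<close>, so its determinant is a polynomial in \<open>c\<close>.
\<close>

lemma stab_at_nontrivial_iff:
  fixes F :: "'a::complex_algebra \<Rightarrow> complex"
  assumes "coordinates m e co" and F: "F \<in> dual_space"
  shows "stab_at F c \<noteq> {0} \<longleftrightarrow> gram_det m (\<lambda>i j. F (e i * e j) + c * (- F (e j * e i))) = 0"
proof -
  interpret coordinates m e co by fact
  have pair: "F ((\<Sum>i<m. v i *\<^sub>C e i) * e j) - c * F (e j * (\<Sum>i<m. v i *\<^sub>C e i))
      = (\<Sum>i<m. v i * (F (e i * e j) + c * (- F (e j * e i))))" for v j
    by (simp add: sum_distrib_left sum_distrib_right dual_sum[OF F] dual_scale[OF F] mult_scaleC_left
        mult_scaleC_right algebra_simps sum_subtractf)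
  have mem: "a \<in> stab_at F c" if "\<forall>j<m. F (a * e j) = c * F (e j * a)" for a
  proof -
    have "F (a * x) = c * F (x * a)" for x
    proof -
      have "F (a * (\<Sum>j<m. co j x *\<^sub>C e j)) = c * F ((\<Sum>j<m. co j x *\<^sub>C e j) * a)"
        using that by (simp add: sum_distrib_left sum_distrib_right dual_sum[OF F] dual_scale[OF F]
            mult_scaleC_left mult_scaleC_right mult.left_commute)
      then show ?thesis by (simp only: expand)
    qed
    then show ?thesis by (simp add: stab_at_def)
  qed
  show ?thesis
  proof
    assume "stab_at F c \<noteq> {0}"
    then obtain a where a: "a \<in> stab_at F c" "a \<noteq> 0"
      using zero_in_stab_at[OF F, of c] by blast
    have "(\<Sum>i<m. co i a * (F (e i * e j) + c * (- F (e j * e i)))) = 0" for j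
    proof -
      have "F (a * e j) = c * F (e j * a)"
        using a(1) unfolding stab_at_def by blast
      then show ?thesis
        using pair[of "\<lambda>i. co i a" j] unfolding expand by (simp only: diff_self)
    qed
    then show "gram_det m (\<lambda>i j. F (e i * e j) + c * (- F (e j * e i))) = 0"
      using coordinate_nonzero[OF a(2)] unfolding gram_det_eq_0_iff
      by (intro exI[of _ "\<lambda>i. co i a"] conjI allI impI)
  next
    assume "gram_det m (\<lambda>i j. F (e i * e j) + c * (- F (e j * e i))) = 0"
    then obtain v where v: "\<exists>i<m. v i \<noteq> 0"
        "\<forall>j<m. (\<Sum>i<m. v i * (F (e i * e j) + c * (- F (e j * e i)))) = 0"
      unfolding gram_det_eq_0_iff by blast
    let ?a = "\<Sum>i<m. v i *\<^sub>C e i"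
    have "?a \<in> stab_at F c"
    proof (rule mem, intro allI impI)
      fix j assume "j < m"
      then have "F (?a * e j) - c * F (e j * ?a) = 0"
        unfolding pair using v(2) by blast
      then show "F (?a * e j) = c * F (e j * ?a)"
        by (simp only: right_minus_eq)
    qed
    moreover have "?a \<noteq> 0"
    proof
      assume "?a = 0"
      then have "v j = 0" if "j < m" for j
        using co_combination[OF that, of v] dual_zero[OF co_dual[OF that]] by simp
      then show False using v(1) by blast
    qed
    ultimately show "stab_at F c \<noteq> {0}" by blast
  qed
qed

lemma finite_nontrivial_stab_at:
  fixes F :: "'a::complex_algebra \<Rightarrow> complex"
  assumes "finite_dim TYPE('a)" "F \<in> dual_space" "stab_at F d = {0}"
  shows "finite {c. stab_at F c \<noteq> {0}}"
proof -
  obtain m and e :: "nat \<Rightarrow> 'a" and co where coord: "coordinates m e co"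
    using coordinates_exist[OF assms(1)] .
  obtain p where p: "\<And>t. poly p t = gram_det m (\<lambda>i j. F (e i * e j) + t * (- F (e j * e i)))"
    using gram_det_pencil_poly[of m "\<lambda>i j. F (e i * e j)" "\<lambda>i j. - F (e j * e i)"] by blast
  have "poly p d \<noteq> 0"
    using assms(3) stab_at_nontrivial_iff[OF coord assms(2), of d] by (simp add: p)
  then have "finite {c. poly p c = 0}"
    by (intro poly_roots_finite) auto
  then show ?thesis
    by (simp add: p stab_at_nontrivial_iff[OF coord assms(2)])
qed

text \<open>
  Transposing the Gram matrix for the twist \<open>c\<close> gives, up to the factor \<open>- c\<close>, the Gram matrix for
  the twist \<open>1 / c\<close>; a square matrix and its transpose are singular simultaneously.
\<close>

lemma stab_at_inverse_nontrivial:
  fixes F :: "'a::complex_algebra \<Rightarrow> complex"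
  assumes "finite_dim TYPE('a)" "F \<in> dual_space" "c \<noteq> 0" "stab_at F c \<noteq> {0}"
  shows "stab_at F (inverse c) \<noteq> {0}"
proof -
  obtain m and e :: "nat \<Rightarrow> 'a" and co where coord: "coordinates m e co"
    using coordinates_exist[OF assms(1)] .
  have "(\<lambda>i j. F (e i * e j) + inverse c * (- F (e j * e i)))
      = (\<lambda>i j. (- inverse c) * (F (e j * e i) + c * (- F (e i * e j))))"
    using assms(3) by (intro ext) (simp add: field_simps)
  then have "gram_det m (\<lambda>i j. F (e i * e j) + inverse c * (- F (e j * e i))) = 0 \<longleftrightarrow>
      gram_det m (\<lambda>i j. F (e j * e i) + c * (- F (e i * e j))) = 0"
    using gram_det_scale_eq_0[of "- inverse c"] assms(3) by simp
  also have "\<dots> \<longleftrightarrow> gram_det m (\<lambda>i j. F (e i * e j) + c * (- F (e j * e i))) = 0"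
    by (subst gram_det_transpose) (rule refl)
  finally show ?thesis
    using assms(4) unfolding stab_at_nontrivial_iff[OF coord assms(2)] by blast
qed

text \<open>
  The defining equation of a twisted stabilising element is closed in the functional, the twist and the
  element.  With compactness, nontrivial twisted stabilisers cannot disappear in the limit.
\<close>

lemma stab_at_limit:
  fixes G :: "'a::complex_algebra \<Rightarrow> complex"
  assumes fd: "finite_dim TYPE('a)"
    and H: "\<And>k. H k \<in> dual_space" "G \<in> dual_space" "\<And>x. (\<lambda>k. H k x) \<longlonglongrightarrow> G x"
    and c: "c \<longlonglongrightarrow> d" and nontriv: "\<And>k. stab_at (H k) (c k) \<noteq> {0}"
  obtains r x a where "strict_mono r" "\<And>k. x k \<in> stab_at (H (r k)) (c (r k))"
    "a \<in> stab_at G d" "a \<noteq> 0" "weakly_tendsto x a"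
proof -
  obtain m and e :: "nat \<Rightarrow> 'a" and co where "coordinates m e co"
    using coordinates_exist[OF fd] .
  then interpret coordinates m e co .
  have "\<forall>k. \<exists>z. z \<in> stab_at (H k) (c k) \<and> z \<noteq> 0"
    using nontriv zero_in_stab_at[OF H(1)] by blast
  then obtain z where z: "\<And>k. z k \<in> stab_at (H k) (c k)" "\<And>k. z k \<noteq> 0" by metis
  obtain r s a where r: "strict_mono r" and "\<And>k. s k \<noteq> 0"
      and a: "a \<noteq> 0" "weakly_tendsto (\<lambda>k. s k *\<^sub>C z (r k)) a"
    by (rule limit_of_nonzero_vectors[of z, OF z(2)]) (rule that)
  define x where "x = (\<lambda>k. s k *\<^sub>C z (r k))"
  have x: "x k \<in> stab_at (H (r k)) (c (r k))" for k
    unfolding x_def using z(1) stab_at_subspace[OF H(1)] by (simp add: complex_vector.subspace_scale)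
  have xa: "weakly_tendsto x a"
    using a(2) by (simp add: x_def)
  have "G (a * y) = d * G (y * a)" for y
  proof (rule LIMSEQ_unique)
    have Hr: "(\<lambda>k. H (r k) w) \<longlonglongrightarrow> G w" for w
      using LIMSEQ_subseq_LIMSEQ[OF H(3) r] by (simp add: o_def)
    show "(\<lambda>k. H (r k) (x k * y)) \<longlonglongrightarrow> G (a * y)"
      by (rule tendsto_functionals[of "\<lambda>k w. H (r k) (w * y)" "\<lambda>w. G (w * y)", OF _ _ Hr xa])
        (use H(1,2) in \<open>simp_all add: dual_space_iff distrib_right mult_scaleC_left\<close>)
    have "(\<lambda>k. H (r k) (y * x k)) \<longlonglongrightarrow> G (y * a)"
      by (rule tendsto_functionals[of "\<lambda>k w. H (r k) (y * w)" "\<lambda>w. G (y * w)", OF _ _ Hr xa])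
        (use H(1,2) in \<open>simp_all add: dual_space_iff distrib_left mult_scaleC_right\<close>)
    then have "(\<lambda>k. c (r k) * H (r k) (y * x k)) \<longlonglongrightarrow> d * G (y * a)"
      using LIMSEQ_subseq_LIMSEQ[OF c r] by (intro tendsto_mult) (simp_all add: o_def)
    then show "(\<lambda>k. H (r k) (x k * y)) \<longlonglongrightarrow> d * G (y * a)"
      using x by (simp add: stab_at_def)
  qed
  then have "a \<in> stab_at G d"
    by (simp add: stab_at_def)
  from r x this a(1) xa show ?thesis
    by (rule that)
qed

lemma weakly_tendsto_mult:
  fixes x y :: "nat \<Rightarrow> 'a::complex_algebra"
  assumes "finite_dim TYPE('a)" "weakly_tendsto x a" "weakly_tendsto y b"
  shows "weakly_tendsto (\<lambda>k. x k * y k) (a * b)"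
  unfolding weakly_tendsto_def
proof
  fix F :: "'a \<Rightarrow> complex"
  assume F: "F \<in> dual_space"
  obtain m and e :: "nat \<Rightarrow> 'a" and co where "coordinates m e co"
    using coordinates_exist[OF assms(1)] .
  then interpret coordinates m e co .
  have "(\<lambda>w. F (z * w)) \<in> dual_space" "(\<lambda>w. F (w * z)) \<in> dual_space" for z
    using F by (auto simp: dual_space_iff distrib_left distrib_right mult_scaleC_left mult_scaleC_right)
  note duals = this
  have lim: "(\<lambda>k. F (z * y k)) \<longlonglongrightarrow> F (z * b)" for z
    using weakly_tendstoD[OF assms(3) duals(1)] .
  show "(\<lambda>k. F (x k * y k)) \<longlonglongrightarrow> F (a * b)"
    by (rule tendsto_functionals[of "\<lambda>k w. F (w * y k)" "\<lambda>w. F (w * b)"])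
      (rule duals lim assms(2))+
qed

text \<open>
  Conversely to \<open>stab_at_limit\<close>, a twist with nontrivial stabiliser persists under perturbation of
  the functional, up to a small change of the twist.  Such twists are the roots of a polynomial in
  the twist, and roots move continuously as long as the limit polynomial is not identically zero,
  which is what the twist \<open>d\<close> guarantees.
\<close>

lemma stab_at_nontrivial_nearby:
  fixes G :: "'a::complex_algebra \<Rightarrow> complex"
  assumes fd: "finite_dim TYPE('a)"
    and H: "\<And>k. H k \<in> dual_space" "G \<in> dual_space" "\<And>x. (\<lambda>k. H k x) \<longlonglongrightarrow> G x"
    and c: "stab_at G c \<noteq> {0}" and d: "stab_at G d = {0}" and r: "r > 0"
  shows "\<forall>\<^sub>F k in sequentially. \<exists>c'. dist c' c < r \<and> stab_at (H k) c' \<noteq> {0}"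
proof -
  obtain m and e :: "nat \<Rightarrow> 'a" and co where coord: "coordinates m e co"
    using coordinates_exist[OF fd] .
  \<comment> \<open>The finitely many exceptional twists of \<open>G\<close> leave one inside the half-size disc.\<close>
  have "infinite (cball c (r / 2))"
    using r by (simp add: uncountable_infinite uncountable_cball)
  then obtain d' where d': "d' \<in> cball c (r / 2)" "stab_at G d' = {0}"
    using finite_nontrivial_stab_at[OF fd H(2) d]
    by (metis (mono_tags, lifting) finite_subset mem_Collect_eq subsetI)
  define g where "g = (\<lambda>F z. gram_det m (\<lambda>i j. F (e i * e j) + z * (- F (e j * e i))))"
  have nontriv: "stab_at F z \<noteq> {0} \<longleftrightarrow> g F z = 0" if "F \<in> dual_space" for F z
    using stab_at_nontrivial_iff[OF coord that] by (simp add: g_def)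
  have lim: "(\<lambda>k. g (H k) z) \<longlonglongrightarrow> g G z" for z
    unfolding g_def by (intro tendsto_gram_det tendsto_intros H(3))
  have "(\<lambda>k. (2 / 3) ^ m * norm (g (H k) d') - norm (g (H k) c)) \<longlonglongrightarrow>
      (2 / 3) ^ m * norm (g G d') - norm (g G c)"
    by (intro tendsto_intros lim)
  moreover have "(2 / 3) ^ m * norm (g G d') - norm (g G c) > 0"
  proof -
    have "g G c = 0" "g G d' \<noteq> 0"
      using c d'(2) nontriv[OF H(2), of c] nontriv[OF H(2), of d'] by blast+
    then show ?thesis by simp
  qed
  ultimately have "\<forall>\<^sub>F k in sequentially. (2 / 3) ^ m * norm (g (H k) d') - norm (g (H k) c) > 0"
    by (rule order_tendstoD)
  then show ?thesis
  proof eventually_elim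
    case (elim k)
    obtain p where p: "degree p \<le> m" "\<And>z. poly p z = g (H k) z"
      unfolding g_def
      using gram_det_pencil_poly[of m "\<lambda>i j. H k (e i * e j)" "\<lambda>i j. - H k (e j * e i)"] by blast
    have "dist d' c \<le> r / 2"
      using d'(1) by (simp add: dist_commute)
    then have "\<exists>z. dist z c < r \<and> poly p z = 0"
      using root_free_disc_lower_bound[OF p(1) _ _ r, of c d'] elim unfolding p(2) by force
    then show ?case
      using nontriv[OF H(1)] p(2) by auto
  qed
qed

text \<open>
  The source of the lower bound for the index.  The functionals \<open>H k\<close> need not have nonzero
  stabilising elements for the twist \<open>c\<close> itself, but they have some for twists \<open>c'\<close> close to \<open>c\<close>, and
  then also for \<open>1 / c'\<close>.  Since the stabilisers of \<open>G\<close> for \<open>c\<close> and \<open>1 / c\<close> are lines, the corresponding elements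
  are forced to be close to multiples of \<open>a\<close> and \<open>b\<close>.  Their product lies in the untwisted
  stabiliser, whatever \<open>c'\<close> is, and is close to a multiple of \<open>a * b\<close>.
\<close>

lemma approximate_stabiliser:
  fixes G :: "'a::complex_algebra \<Rightarrow> complex"
  assumes fd: "finite_dim TYPE('a)"
    and H: "\<And>k. H k \<in> dual_space" "G \<in> dual_space" "\<And>x. (\<lambda>k. H k x) \<longlonglongrightarrow> G x"
    and c: "c \<noteq> 0" and d: "stab_at G d = {0}"
    and a: "a \<noteq> 0" "\<And>x. x \<in> stab_at G c \<Longrightarrow> \<exists>s. x = s *\<^sub>C a" "a \<in> stab_at G c"
    and b: "\<And>x. x \<in> stab_at G (inverse c) \<Longrightarrow> \<exists>s. x = s *\<^sub>C b"
    and \<Phi>: "finite \<Phi>" "\<Phi> \<subseteq> dual_space" and \<epsilon>: "\<epsilon> > (0::real)"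
  shows "\<forall>\<^sub>F k in sequentially. \<exists>z\<in>stab (H k). \<forall>F\<in>\<Phi>. dist (F z) (F (a * b)) < \<epsilon>"
proof (rule ccontr)
  define bad where "bad = (\<lambda>k. \<not> (\<exists>z\<in>stab (H k). \<forall>F\<in>\<Phi>. dist (F z) (F (a * b)) < \<epsilon>))"
  assume "\<not> ?thesis"
  then have freq: "\<exists>\<^sub>F k in sequentially. bad k"
    by (simp add: bad_def frequently_def)
  have "stab_at G c \<noteq> {0}" using a(1,3) by auto
  \<comment> \<open>Keeping the twist closer to \<open>c\<close> than \<open>norm c\<close> ensures that it can be inverted.\<close>
  have "\<exists>k c'. j \<le> k \<and> bad k \<and> dist c' c < inverse (Suc j) \<and> c' \<noteq> 0 \<and> stab_at (H k) c' \<noteq> {0}" for j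
  proof -
    have "\<forall>\<^sub>F k in sequentially. \<exists>c'. dist c' c < min (inverse (Suc j)) (norm c) \<and> stab_at (H k) c' \<noteq> {0}"
      using c by (intro stab_at_nontrivial_nearby[OF fd H \<open>stab_at G c \<noteq> {0}\<close> d]) auto
    then have "\<forall>\<^sub>F k in sequentially. j \<le> k \<and>
        (\<exists>c'. dist c' c < min (inverse (Suc j)) (norm c) \<and> stab_at (H k) c' \<noteq> {0})"
      by (intro eventually_conj eventually_ge_at_top)
    then have "\<exists>k. bad k \<and> j \<le> k \<and>
        (\<exists>c'. dist c' c < min (inverse (Suc j)) (norm c) \<and> stab_at (H k) c' \<noteq> {0})"
      by (rule frequently_ex[OF frequently_eventually_frequently[OF freq]])
    then obtain k where "bad k" "j \<le> k"
        "\<exists>c'. dist c' c < min (inverse (Suc j)) (norm c) \<and> stab_at (H k) c' \<noteq> {0}"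
      by blast
    moreover then obtain c' where
        "dist c' c < min (inverse (Suc j)) (norm c)" "stab_at (H k) c' \<noteq> {0}" by blast
    moreover from this have "c' \<noteq> 0" by (intro notI) simp
    ultimately show ?thesis
      by (intro exI[of _ k] exI[of _ c'] conjI) simp_all
  qed
  then obtain \<kappa> \<gamma> where \<kappa>: "\<And>j. j \<le> \<kappa> j" "\<And>j. bad (\<kappa> j)" and \<gamma>: "\<And>j. dist (\<gamma> j) c < inverse (Suc j)"
      "\<And>j. \<gamma> j \<noteq> 0" "\<And>j. stab_at (H (\<kappa> j)) (\<gamma> j) \<noteq> {0}"
    by metis
  have "filterlim \<kappa> at_top sequentially"
    by (rule filterlim_at_top_mono[OF filterlim_ident]) (simp add: \<kappa>(1))
  then have H\<kappa>: "(\<lambda>j. H (\<kappa> j) x) \<longlonglongrightarrow> G x" for x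
    by (rule filterlim_compose[OF H(3)])
  have "(\<lambda>j. dist (\<gamma> j) c) \<longlonglongrightarrow> 0"
    by (rule tendsto_sandwich[OF _ _ tendsto_const LIMSEQ_inverse_real_of_nat])
      (intro eventuallyI zero_le_dist less_imp_le \<gamma>(1))+
  then have \<gamma>lim: "\<gamma> \<longlonglongrightarrow> c"
    by (rule tendsto_dist_iff[THEN iffD2])
  obtain r x a' where r: "strict_mono r" and x: "\<And>j. x j \<in> stab_at (H (\<kappa> (r j))) (\<gamma> (r j))"
      and a': "a' \<in> stab_at G c" "a' \<noteq> 0" "weakly_tendsto x a'"
    by (rule stab_at_limit[OF fd H(1) H(2) H\<kappa> \<gamma>lim \<gamma>(3)]) (rule that)
  have inv_lim: "(\<lambda>j. inverse (\<gamma> (r j))) \<longlonglongrightarrow> inverse c"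
    using LIMSEQ_subseq_LIMSEQ[OF \<gamma>lim r] c by (intro tendsto_inverse) (auto simp: o_def)
  have H\<kappa>r: "(\<lambda>j. H (\<kappa> (r j)) x) \<longlonglongrightarrow> G x" for x
    using LIMSEQ_subseq_LIMSEQ[OF H\<kappa> r] by (simp add: o_def)
  obtain r' y b' where r': "strict_mono r'"
      and y: "\<And>j. y j \<in> stab_at (H (\<kappa> (r (r' j)))) (inverse (\<gamma> (r (r' j))))"
      and b': "b' \<in> stab_at G (inverse c)" "b' \<noteq> 0" "weakly_tendsto y b'"
    by (rule stab_at_limit[OF fd H(1) H(2) H\<kappa>r inv_lim stab_at_inverse_nontrivial[OF fd H(1) \<gamma>(2,3)]]) (rule that)
  obtain s where s: "a' = s *\<^sub>C a" "s \<noteq> 0"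
    using a(2)[OF a'(1)] a'(2) by auto
  obtain t where t: "b' = t *\<^sub>C b" "t \<noteq> 0"
    using b[OF b'(1)] b'(2) by auto
  define z where "z = (\<lambda>j. inverse (s * t) *\<^sub>C (x (r' j) * y j))"
  have z_stab: "z j \<in> stab (H (\<kappa> (r (r' j))))" for j
  proof -
    have "x (r' j) * y j \<in> stab_at (H (\<kappa> (r (r' j)))) 1"
      using stab_at_mult[OF x[of "r' j"] y[of j]] \<gamma>(2) by simp
    then show ?thesis
      unfolding z_def stab_eq_stab_at
      by (rule complex_vector.subspace_scale[OF stab_at_subspace[OF H(1)]])
  qed
  have "(\<lambda>j. F (z j)) \<longlonglongrightarrow> F (a * b)" if F: "F \<in> \<Phi>" for F
  proof -
    have F: "F \<in> dual_space" using F \<Phi>(2) by blast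
    have "(\<lambda>j. F (x (r' j) * y j)) \<longlonglongrightarrow> F (a' * b')"
      using weakly_tendsto_mult[OF fd weakly_tendsto_subseq[OF a'(3) r'] b'(3)] F
      by (simp add: weakly_tendsto_def)
    then have "(\<lambda>j. inverse (s * t) * F (x (r' j) * y j)) \<longlonglongrightarrow> inverse (s * t) * F (a' * b')"
      by (intro tendsto_mult tendsto_const)
    moreover have "inverse (s * t) * F (a' * b') = F (a * b)"
      using s(2) t(2)
      by (simp add: s(1) t(1) dual_scale[OF F] mult_scaleC_left mult_scaleC_right field_simps)
    ultimately show ?thesis
      by (simp only: z_def dual_scale[OF F])
  qed
  then have "\<forall>F\<in>\<Phi>. \<forall>\<^sub>F j in sequentially. dist (F (z j)) (F (a * b)) < \<epsilon>"
    using \<epsilon> by (intro ballI tendstoD)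
  then have "\<forall>\<^sub>F j in sequentially. \<forall>F\<in>\<Phi>. dist (F (z j)) (F (a * b)) < \<epsilon>"
    using \<Phi>(1) by (simp add: eventually_ball_finite_distrib)
  then obtain j where "\<forall>F\<in>\<Phi>. dist (F (z j)) (F (a * b)) < \<epsilon>"
    using eventually_happens'[OF sequentially_bot] by blast
  then show False
    using z_stab[of j] \<kappa>(2)[of "r (r' j)"] unfolding bad_def by blast
qed

section \<open>Regular functionals and the index\<close>

text \<open>
  The stabiliser of \<open>F\<close> is the radical of the skew form
  \<open>(x, y) \<mapsto> F (x * y - y * x)\<close>, so on a complement \<open>W\<close> of the radical the form is nondegenerate.
  Its Gram determinant on \<open>W\<close> is a polynomial along the line, hence nonzero for all but finitely many
  parameters, and then the stabiliser meets \<open>W\<close> only in zero and is no larger than that of \<open>F\<close>.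
\<close>

lemma dim_stab_pencil:
  fixes F K :: "'a::complex_algebra \<Rightarrow> complex"
  assumes fd: "finite_dim TYPE('a)" and F: "F \<in> dual_space" and K: "K \<in> dual_space"
  shows "finite {t. \<not> complex_vector.dim (stab (\<lambda>x. F x + t * K x)) \<le> complex_vector.dim (stab F)}"
proof -
  obtain U where U: "U \<subseteq> stab F" "complex_vector.independent U" "stab F \<subseteq> complex_vector.span U"
      "card U = complex_vector.dim (stab F)"
    using complex_vector.basis_exists[of "stab F"] .
  obtain B where B1: "U \<subseteq> B" and "B \<subseteq> UNIV" and B2: "complex_vector.independent B"
      and B3: "UNIV \<subseteq> complex_vector.span B"
    using complex_vector.maximal_independent_subset_extend[OF subset_UNIV U(2)] .
  note B = B1 B2 B3
  obtain S :: "'a set" where S: "finite S" "complex_vector.span S = UNIV"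
    using fd unfolding finite_dim_def by blast
  have finB: "finite B"
    using complex_vector.independent_span_bound[OF S(1) B(2)] S(2) by simp
  interpret V: finite_dimensional_vector_space "scaleC :: complex \<Rightarrow> 'a \<Rightarrow> 'a" B
    by unfold_locales (use finB B in auto)
  define W where "W = complex_vector.span (B - U)"
  define r where "r = card (B - U)"
  obtain e where e: "bij_betw e {..<r} (B - U)"
    using ex_bij_betw_nat_finite[of "B - U"] finB by (auto simp: r_def lessThan_atLeast0)
  define \<rho> where "\<rho> = (\<lambda>x i. complex_vector.representation B x (e i))"
  have combination: "(\<Sum>i<r. \<rho> x i *\<^sub>C e i) = x" if "x \<in> W" for x
  proof -
    have "complex_vector.representation B x = complex_vector.representation (B - U) x"
      using that unfolding W_def by (intro complex_vector.representation_extend B(2)) auto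
    then have "(\<Sum>i<r. \<rho> x i *\<^sub>C e i) = (\<Sum>b\<in>B - U. complex_vector.representation (B - U) x b *\<^sub>C b)"
      unfolding \<rho>_def using sum.reindex_bij_betw[OF e] by simp
    also have "\<dots> = x"
      using that finB complex_vector.independent_mono[OF B(2), of "B - U"] unfolding W_def
      by (intro complex_vector.sum_representation_eq) auto
    finally show ?thesis .
  qed
  have coord: "\<rho> (\<Sum>i<r. v i *\<^sub>C e i) j = v j" if "j < r" for v j
  proof -
    have eB: "e i \<in> B" if "i < r" for i
      using bij_betwE[OF e] that by blast
    have "\<rho> (\<Sum>i<r. v i *\<^sub>C e i) j = (\<Sum>i<r. v i * \<rho> (e i) j)"
      unfolding \<rho>_def using B(2,3)
      by (simp add: complex_vector.representation_sum complex_vector.representation_scale top.extremum_unique)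
    also have "\<dots> = (\<Sum>i<r. if i = j then v i else 0)"
      unfolding \<rho>_def using that e
      by (intro sum.cong refl)
        (auto simp: complex_vector.representation_basis[OF B(2) eB] bij_betw_def inj_on_def)
    finally show ?thesis using that by simp
  qed
  have e_in_W: "e i \<in> W" if "i < r" for i
    using bij_betwE[OF e] that by (auto simp: W_def intro: complex_vector.span_base)
  define skew where "skew = (\<lambda>F (x::'a) y. F (x * y) - F (y * x) :: complex)"
  have stab_iff: "x \<in> stab H \<longleftrightarrow> (\<forall>y. skew H x y = 0)" for H x
    by (simp add: stab_def skew_def)
  have skew_sum: "skew H (\<Sum>i<r. v i *\<^sub>C e i) y = (\<Sum>i<r. v i * skew H (e i) y)"
    if "H \<in> dual_space" for H v y
    by (simp add: skew_def sum_distrib_left sum_distrib_right dual_sum[OF that] dual_scale[OF that]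
        mult_scaleC_left mult_scaleC_right right_diff_distrib sum_subtractf)
  define g where "g = (\<lambda>t. gram_det r (\<lambda>i j. skew F (e i) (e j) + t * skew K (e i) (e j)))"
  \<comment> \<open>By skewness a vector of \<open>W\<close> orthogonal to \<open>W\<close> is orthogonal to everything, as \<open>U\<close> lies in
    the radical; so it lies in \<open>W\<close> and in the span of \<open>U\<close>.\<close>
  have "g 0 \<noteq> 0"
  proof
    assume "g 0 = 0"
    then obtain v where v: "\<exists>i<r. v i \<noteq> 0" "\<forall>j<r. (\<Sum>i<r. v i * skew F (e i) (e j)) = 0"
      unfolding g_def gram_det_eq_0_iff by auto
    define x where "x = (\<Sum>i<r. v i *\<^sub>C e i)"
    have "skew F x b = 0" if "b \<in> B" for b
    proof (cases "b \<in> U")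
      case True
      then show ?thesis
        using U(1) unfolding skew_def stab_def by auto
    next
      case False
      then have "b \<in> e ` {..<r}"
        using that e by (simp add: bij_betw_def)
      then obtain j where "j < r" "b = e j"
        by blast
      then show ?thesis
        using v(2) by (simp add: x_def skew_sum[OF F])
    qed
    moreover have "complex_vector.subspace {y. skew F x y = 0}"
      unfolding skew_def using F
      by (auto simp: complex_vector.subspace_def distrib_left distrib_right dual_add dual_zero
          mult_scaleC_left mult_scaleC_right dual_scale)
    ultimately have "complex_vector.span B \<subseteq> {y. skew F x y = 0}"
      by (intro complex_vector.span_minimal) auto
    then have "x \<in> stab F"
      using B(3) by (auto simp: stab_iff)
    then have "complex_vector.representation B x = complex_vector.representation U x"
      using U(3) B(1) by (intro complex_vector.representation_extend B(2)) auto
    then have "\<rho> x i = 0" if "i < r" for i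
      using complex_vector.representation_ne_zero[of U x "e i"] bij_betwE[OF e] that
      by (auto simp: \<rho>_def)
    moreover obtain i where "i < r" "v i \<noteq> 0"
      using v(1) by blast
    ultimately show False
      using coord[of i v] by (simp add: x_def)
  qed
  obtain p where "degree p \<le> r" and
      "\<And>t. poly p t = gram_det r (\<lambda>i j. skew F (e i) (e j) + t * skew K (e i) (e j))"
    by (rule gram_det_pencil_poly) (rule that)
  then have p: "poly p t = g t" for t
    by (simp add: g_def)
  have "p \<noteq> 0"
    using \<open>g 0 \<noteq> 0\<close> p[of 0] by auto
  then have fin: "finite {t. g t = 0}"
    using poly_roots_finite[of p] by (simp add: p)
  have "complex_vector.dim (stab (\<lambda>x. F x + t * K x)) \<le> complex_vector.dim (stab F)" if "g t \<noteq> 0" for t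
  proof -
    define H where "H = (\<lambda>x. F x + t * K x)"
    have H: "H \<in> dual_space"
      using dual_combination[OF F K, of 1 t] by (simp add: H_def)
    have subH: "complex_vector.subspace (stab H)"
      using stab_at_subspace[OF H] by (simp add: stab_eq_stab_at)
    have "x = 0" if x: "x \<in> W" "x \<in> stab H" for x
    proof (rule ccontr)
      assume "x \<noteq> 0"
      have "(\<Sum>i<r. \<rho> x i * (skew F (e i) (e j) + t * skew K (e i) (e j))) = 0" for j
      proof -
        have "(\<Sum>i<r. \<rho> x i * (skew F (e i) (e j) + t * skew K (e i) (e j))) = skew H x (e j)"
          using skew_sum[OF H, of "\<rho> x" "e j"] unfolding combination[OF x(1)]
          by (simp add: H_def skew_def algebra_simps)
        then show ?thesis
          using x(2) by (simp only: stab_iff)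
      qed
      moreover have "\<exists>i<r. \<rho> x i \<noteq> 0"
        using combination[OF x(1)] \<open>x \<noteq> 0\<close> by (auto intro: ccontr)
      ultimately have "g t = 0"
        unfolding g_def gram_det_eq_0_iff by (intro exI[of _ "\<rho> x"] conjI allI impI)
      with \<open>g t \<noteq> 0\<close> show False ..
    qed
    then have "W \<inter> stab H = {0}"
      using complex_vector.subspace_0[OF subH] by (auto simp: W_def complex_vector.span_zero)
    moreover have "complex_vector.subspace W"
      by (simp add: W_def)
    ultimately have "complex_vector.dim W + complex_vector.dim (stab H) \<le> card B"
      using V.dim_sums_Int[of W "stab H"] subH V.dim_subset_UNIV[of "{x + y |x y. x \<in> W \<and> y \<in> stab H}"]
      by (simp add: V.dimension_def)
    moreover have "complex_vector.dim W = card (B - U)"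
      unfolding W_def
      by (intro complex_vector.dim_span_eq_card_independent complex_vector.independent_mono[OF B(2)]) auto
    moreover have "card (B - U) = card B - card U" "card U \<le> card B"
      using B(1) finB by (auto intro: card_Diff_subset card_mono finite_subset)
    ultimately show ?thesis
      using U(4) by (simp add: H_def)
  qed
  then have "{t. \<not> complex_vector.dim (stab (\<lambda>x. F x + t * K x)) \<le> complex_vector.dim (stab F)} \<subseteq> {t. g t = 0}"
    by blast
  then show ?thesis
    using fin by (rule finite_subset)
qed

lemma one_regular_exists: "\<exists>F :: 'a::complex_algebra \<Rightarrow> complex. one_regular F"
proof -
  have "(\<lambda>_. 0) \<in> (dual_space :: ('a \<Rightarrow> complex) set)"
    by (simp add: dual_space_iff)
  then have "\<exists>F :: 'a \<Rightarrow> complex. F \<in> dual_space \<and>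
      (\<forall>G :: 'a \<Rightarrow> complex. G \<in> dual_space \<longrightarrow> complex_vector.dim (stab F) \<le> complex_vector.dim (stab G))"
    using ex_has_least_nat[of "\<lambda>F :: 'a \<Rightarrow> complex. F \<in> dual_space" "\<lambda>_. 0" "\<lambda>F. complex_vector.dim (stab F)"]
    by simp
  then obtain F :: "'a \<Rightarrow> complex" where "F \<in> dual_space"
      "\<And>G :: 'a \<Rightarrow> complex. G \<in> dual_space \<Longrightarrow> complex_vector.dim (stab F) \<le> complex_vector.dim (stab G)"
    by blast
  then show ?thesis
    unfolding one_regular_def by (intro exI[of _ F] conjI exI[of _ UNIV]) auto
qed

text \<open>
  On the line from \<open>G\<close> to \<open>F\<close> there are infinitely many points close to \<open>F\<close>, and at all but finitely
  many points the stabiliser is no larger than at \<open>G\<close>; so a local minimum of its dimension is global.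
\<close>

lemma one_regular_minimal:
  fixes F G :: "'a::complex_algebra \<Rightarrow> complex"
  assumes fd: "finite_dim TYPE('a)" and F: "one_regular F" and G: "G \<in> dual_space"
  shows "complex_vector.dim (stab F) \<le> complex_vector.dim (stab G)"
proof -
  obtain U where U: "open U" "F \<in> U"
      "\<And>H. H \<in> U \<Longrightarrow> H \<in> dual_space \<Longrightarrow> complex_vector.dim (stab F) \<le> complex_vector.dim (stab H)"
    and Fd: "F \<in> dual_space"
    using F unfolding one_regular_def by blast
  define K where "K = (\<lambda>x. F x - G x)"
  have K: "K \<in> dual_space"
    using dual_combination[OF Fd G, of 1 "-1"] by (simp add: K_def)
  define line where "line = (\<lambda>t x. G x + t * K x)"
  have "continuous_on UNIV line"
    unfolding line_def by (intro continuous_on_coordinatewise_then_product continuous_intros)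
  then have "open (line -` U)"
    using U(1) open_vimage by blast
  moreover have "1 \<in> line -` U"
    using U(2) by (simp add: line_def K_def)
  ultimately have "infinite (line -` U)"
    using finite_imp_not_open by blast
  then have "\<not> line -` U \<subseteq> {t. \<not> complex_vector.dim (stab (\<lambda>x. G x + t * K x)) \<le> complex_vector.dim (stab G)}"
    using finite_subset[OF _ dim_stab_pencil[OF fd G K]] by (intro notI) (erule notE)
  then obtain t where t: "line t \<in> U" "complex_vector.dim (stab (line t)) \<le> complex_vector.dim (stab G)"
    by (auto simp: line_def)
  have "line t \<in> dual_space"
    using dual_combination[OF G K, of 1 t] by (simp add: line_def)
  then show ?thesis
    using U(3)[OF t(1)] t(2) by linarith
qed

lemma one_regular_dual: "one_regular F \<Longrightarrow> F \<in> dual_space"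
  by (simp add: one_regular_def)

lemma alg_index_attained:
  obtains F :: "'a::complex_algebra \<Rightarrow> complex"
  where "one_regular F" "F \<in> dual_space" "complex_vector.dim (stab F) = alg_index TYPE('a)"
proof -
  have reg: "one_regular (SOME F :: 'a \<Rightarrow> complex. one_regular F)"
    using one_regular_exists by (rule someI_ex)
  show ?thesis
    by (rule that[OF reg one_regular_dual[OF reg]]) (simp add: alg_index_def)
qed

text \<open>
  In a linear relation between the vectors \<open>z i\<close>, the coefficient of largest absolute value would be
  strictly smaller than itself, because the matrix of the values \<open>\<phi> j (z i)\<close> is close to the identity.
\<close>

lemma near_dual_family_dim_ge:
  fixes z :: "'n::finite \<Rightarrow> 'a::complex_vector" and \<phi> :: "'n \<Rightarrow> 'a \<Rightarrow> complex"
  assumes fd: "finite_dim TYPE('a)" and \<phi>: "\<And>j. \<phi> j \<in> dual_space" and z: "\<And>i. z i \<in> V"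
    and close: "\<And>i j. dist (\<phi> j (z i)) (if i = j then 1 else 0) < 1 / CARD('n)"
  shows "CARD('n) \<le> complex_vector.dim V"
proof -
  have indep: "c i = 0" if c: "(\<Sum>i\<in>UNIV. c i *\<^sub>C z i) = 0" for c i
  proof (rule ccontr)
    assume "c i \<noteq> 0"
    have "Max (range (\<lambda>i. norm (c i))) \<in> range (\<lambda>i. norm (c i))"
      by (rule Max_in) auto
    then obtain j where "Max (range (\<lambda>i. norm (c i))) = norm (c j)" by blast
    then have j: "norm (c i) \<le> norm (c j)" for i
      using Max_ge[of "range (\<lambda>i. norm (c i))" "norm (c i)"] by simp
    have cj: "norm (c j) > 0"
      using j[of i] \<open>c i \<noteq> 0\<close> by (meson order_less_le_trans zero_less_norm_iff)
    have "(\<Sum>i\<in>UNIV. c i * \<phi> j (z i)) = 0"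
      using arg_cong[OF c, of "\<phi> j"] by (simp add: dual_sum \<phi> dual_scale dual_zero)
    moreover have "(\<Sum>i\<in>UNIV. c i * (if i = j then 1 else 0)) = c j"
      by (simp add: if_distrib cong: if_cong)
    ultimately have "c j = - (\<Sum>i\<in>UNIV. c i * (\<phi> j (z i) - (if i = j then 1 else 0)))"
      by (simp only: right_diff_distrib sum_subtractf diff_0 minus_minus)
    then have "norm (c j) = norm (- (\<Sum>i\<in>UNIV. c i * (\<phi> j (z i) - (if i = j then 1 else 0))))"
      by (rule arg_cong)
    also have "\<dots> = norm (\<Sum>i\<in>UNIV. c i * (\<phi> j (z i) - (if i = j then 1 else 0)))"
      by (rule norm_minus_cancel)
    also have "\<dots> \<le> (\<Sum>i\<in>UNIV. norm (c i * (\<phi> j (z i) - (if i = j then 1 else 0))))"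
      by (rule norm_sum)
    also have "\<dots> < (\<Sum>i\<in>(UNIV::'n set). norm (c j) * (1 / CARD('n)))"
    proof (rule sum_strict_mono)
      fix i
      have "norm (c i) * dist (\<phi> j (z i)) (if i = j then 1 else 0)
          \<le> norm (c j) * dist (\<phi> j (z i)) (if i = j then 1 else 0)"
        using j by (intro mult_right_mono) auto
      also have "\<dots> < norm (c j) * (1 / CARD('n))"
        using close[of j i] cj by (intro mult_strict_left_mono)
      finally show "norm (c i * (\<phi> j (z i) - (if i = j then 1 else 0))) < norm (c j) * (1 / CARD('n))"
        by (simp add: norm_mult dist_norm)
    qed auto
    also have "\<dots> = norm (c j)" by simp
    finally show False by simp
  qed
  have inj: "inj z"
  proof (rule injI, rule ccontr)
    fix i j assume ij: "z i = z j" "i \<noteq> j"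
    define c where "c = (\<lambda>k. if k = i then 1 else if k = j then - 1 else (0::complex))"
    have "(\<Sum>k\<in>UNIV. c k *\<^sub>C z k) = (\<Sum>k\<in>{i, j}. c k *\<^sub>C z k)"
      by (intro sum.mono_neutral_right) (auto simp: c_def)
    also have "\<dots> = 0"
      using ij by (simp add: c_def scaleC_one)
    finally show False
      using indep[of c i] by (simp add: c_def)
  qed
  have ind: "complex_vector.independent (range z)"
  proof (rule complex_vector.independent_if_scalars_zero)
    fix f x assume f: "(\<Sum>x\<in>range z. f x *\<^sub>C x) = 0" and x: "x \<in> range z"
    then have "(\<Sum>i\<in>UNIV. f (z i) *\<^sub>C z i) = 0"
      by (simp add: sum.reindex[OF inj])
    then show "f x = 0"
      using indep[of "\<lambda>i. f (z i)"] x by auto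
  qed simp
  obtain B :: "'a set" where "finite B" "complex_vector.independent B" "complex_vector.span B = UNIV"
    using finite_basis_exists[OF fd] .
  then interpret W: finite_dimensional_vector_space "scaleC :: complex \<Rightarrow> 'a \<Rightarrow> 'a" B
    by unfold_locales
  have "card (range z) \<le> complex_vector.dim V"
    by (rule W.independent_card_le_dim[OF _ ind]) (use z in auto)
  then show ?thesis
    by (simp add: card_image[OF inj])
qed

section \<open>Matrices over an algebra as a tensor product\<close>

lemma tensor_induct [case_names zero add scale pure]:
  fixes x :: "'a::complex_vector \<otimes> 'b::complex_vector"
  assumes "P 0" "\<And>x y. P x \<Longrightarrow> P y \<Longrightarrow> P (x + y)" "\<And>c x. P x \<Longrightarrow> P (c *\<^sub>C x)"
    and "\<And>a b. P (pure_tensor a b)"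
  shows "P x"
proof (induction x rule: tensor.abs_induct)
  case (1 y)
  show "P (abs_tensor y)"
  proof (induction y rule: free_pairs_induct)
    case zero
    then show ?case using assms(1) by (simp add: zero_tensor.abs_eq)
  next
    case (add x y)
    then show ?case using assms(2) by (simp flip: plus_tensor.abs_eq)
  next
    case (scale c x)
    then show ?case using assms(3) by (simp flip: scaleC_tensor.abs_eq)
  next
    case (gen a b)
    then show ?case using assms(4) by (simp flip: pure_tensor.abs_eq)
  qed
qed

lemma pure_tensor_add_left: "pure_tensor (a + a') b = pure_tensor a b + pure_tensor a' b"
proof transfer
  fix a a' :: 'a and b :: 'b
  have "gen (a + a') b - gen a b - gen a' b \<in> tensor_relators"
    unfolding tensor_relators_def by blast
  then show "tensor_rel (gen (a + a') b) (gen a b + gen a' b)"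
    by (simp add: tensor_rel_def complex_vector.span_base diff_diff_add)
qed

lemma pure_tensor_add_right: "pure_tensor a (b + b') = pure_tensor a b + pure_tensor a b'"
proof transfer
  fix a :: 'a and b b' :: 'b
  have "gen a (b + b') - gen a b - gen a b' \<in> tensor_relators"
    unfolding tensor_relators_def by blast
  then show "tensor_rel (gen a (b + b')) (gen a b + gen a b')"
    by (simp add: tensor_rel_def complex_vector.span_base diff_diff_add)
qed

lemma pure_tensor_scale_left: "pure_tensor (c *\<^sub>C a) b = c *\<^sub>C pure_tensor a b"
proof transfer
  fix c and a :: 'a and b :: 'b
  have "gen (c *\<^sub>C a) b - c *\<^sub>C gen a b \<in> tensor_relators"
    unfolding tensor_relators_def by blast
  then show "tensor_rel (gen (c *\<^sub>C a) b) (c *\<^sub>C gen a b)"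
    by (simp add: tensor_rel_def complex_vector.span_base)
qed

lemma pure_tensor_scale_right: "pure_tensor a (c *\<^sub>C b) = c *\<^sub>C pure_tensor a b"
proof transfer
  fix c and a :: 'a and b :: 'b
  have "gen a (c *\<^sub>C b) - c *\<^sub>C gen a b \<in> tensor_relators"
    unfolding tensor_relators_def by blast
  then show "tensor_rel (gen a (c *\<^sub>C b)) (c *\<^sub>C gen a b)"
    by (simp add: tensor_rel_def complex_vector.span_base)
qed

lemma pure_tensor_zero: "pure_tensor 0 b = 0" "pure_tensor a 0 = 0"
  using pure_tensor_add_left[of 0 0 b] pure_tensor_add_right[of a 0 0] by simp_all

lemma pure_tensor_sum_left: "pure_tensor (\<Sum>i\<in>I. f i) b = (\<Sum>i\<in>I. pure_tensor (f i) b)"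
  by (induction I rule: infinite_finite_induct) (simp_all add: pure_tensor_zero pure_tensor_add_left)

abbreviation mentry :: "'n cmatrix \<Rightarrow> 'n \<Rightarrow> 'n::finite \<Rightarrow> complex" where
  "mentry M i j \<equiv> vec_nth (vec_nth (matrix_of M) i) j"

text \<open>
  Linear extension of \<open>(M, b) \<mapsto> M\<^sub>i\<^sub>j b\<close> to the free vector space on pairs, so that it descends to the
  tensor product.
\<close>

definition free_entry ::
  "'n::finite \<Rightarrow> 'n \<Rightarrow> ('n cmatrix, 'b::complex_vector) free_pairs \<Rightarrow> 'b" where
  "free_entry i j x = (\<Sum>p\<in>Poly_Mapping.keys x.
     (Poly_Mapping.lookup x p * mentry (fst p) i j) *\<^sub>C snd p)"

lemma free_entry_superset:
  assumes "finite S" "Poly_Mapping.keys x \<subseteq> S"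
  shows "free_entry i j x = (\<Sum>p\<in>S. (Poly_Mapping.lookup x p * mentry (fst p) i j) *\<^sub>C snd p)"
  unfolding free_entry_def using assms by (intro sum.mono_neutral_left) (auto simp: in_keys_iff)

lemma free_entry_add: "free_entry i j (x + y) = free_entry i j x + free_entry i j y"
  using free_entry_superset[of "Poly_Mapping.keys x \<union> Poly_Mapping.keys y"]
  by (simp add: Poly_Mapping.keys_add lookup_add scaleC_add_left distrib_right sum.distrib)

lemma free_entry_scale: "free_entry i j (c *\<^sub>C x) = c *\<^sub>C free_entry i j x"
  using free_entry_superset[of "Poly_Mapping.keys x" "c *\<^sub>C x"]
  by (simp add: keys_scaleC lookup_scaleC scaleC_complex_def free_entry_def
      complex_vector.scale_sum_right mult.assoc)

lemma free_entry_gen: "free_entry i j (gen M b) = mentry M i j *\<^sub>C b"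
  by (simp add: free_entry_def)

lemma free_entry_diff: "free_entry i j (x - y) = free_entry i j x - free_entry i j y"
  using free_entry_add[of i j "x - y" y] by (simp add: algebra_simps)

lemma free_entry_span_relators:
  assumes "x \<in> complex_vector.span tensor_relators"
  shows "free_entry i j x = 0"
  using assms
proof (induction rule: complex_vector.span_induct_alt)
  case base
  show ?case by (simp add: free_entry_def)
next
  case (step c x y)
  have "free_entry i j x = 0"
    using step(1) unfolding tensor_relators_def
    by (auto simp: free_entry_diff free_entry_scale free_entry_gen plus_cmatrix.rep_eq
        scaleC_cmatrix.rep_eq scaleC_add_left scaleC_add_right scaleC_scaleC mult.commute)
  with step show ?case
    by (simp add: free_entry_add free_entry_scale)
qed

text \<open>
  The entries of an element of the tensor product, read as a matrix over the second factor.  Together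
  with \<open>block\<close> they identify the tensor product with the matrix algebra over that factor.
\<close>

lift_definition entry :: "'n::finite \<Rightarrow> 'n \<Rightarrow> ('n cmatrix \<otimes> 'b::complex_vector) \<Rightarrow> 'b" is free_entry
  unfolding tensor_rel_def using free_entry_span_relators free_entry_diff
  by (metis right_minus_eq)

lemma entry_add: "entry i j (X + Y) = entry i j X + entry i j Y"
  by transfer (rule free_entry_add)

lemma entry_scale: "entry i j (c *\<^sub>C X) = c *\<^sub>C entry i j X"
  by transfer (rule free_entry_scale)

lemma entry_pure: "entry i j (pure_tensor M b) = mentry M i j *\<^sub>C b"
  by transfer (rule free_entry_gen)

lemma entry_zero: "entry i j 0 = 0"
  using entry_add[of i j 0 0] by simp

lemma entry_mult:
  fixes X Y :: "'n::finite cmatrix \<otimes> 'b::complex_algebra"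
  shows "entry i j (X * Y) = (\<Sum>k\<in>UNIV. entry i k X * entry k j Y)"
proof (induction X rule: tensor_induct)
  case (pure M b)
  show ?case
  proof (induction Y rule: tensor_induct)
    case (pure N d)
    show ?case
      by (simp add: pure_tensor_mult entry_pure times_cmatrix.rep_eq matrix_matrix_mult_def
          complex_vector.scale_sum_left mult_scaleC_left mult_scaleC_right scaleC_scaleC
          mult.commute)
  qed (simp_all add: entry_zero entry_add entry_scale distrib_left sum.distrib mult_scaleC_right
      complex_vector.scale_sum_right)
qed (simp_all add: entry_zero entry_add entry_scale distrib_right sum.distrib mult_scaleC_left
    complex_vector.scale_sum_right)

definition matrix_unit :: "'n::finite \<Rightarrow> 'n \<Rightarrow> 'n cmatrix" where
  "matrix_unit i j = cmatrix_of (\<chi> k l. if k = i \<and> l = j then 1 else 0)"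

lemma matrix_unit_entry: "mentry (matrix_unit i j) k l = (if k = i \<and> l = j then 1 else 0)"
  by (simp add: matrix_unit_def cmatrix_of_inverse)

definition block :: "'n::finite \<Rightarrow> 'n \<Rightarrow> 'b::complex_vector \<Rightarrow> 'n cmatrix \<otimes> 'b" where
  "block i j b = pure_tensor (matrix_unit i j) b"

lemma entry_block: "entry k l (block i j b) = (if k = i \<and> l = j then b else 0)"
  by (simp add: block_def entry_pure matrix_unit_entry scaleC_one)

lemma block_add: "block i j (b + c) = block i j b + block i j c"
  by (simp add: block_def pure_tensor_add_right)

lemma block_scale: "block i j (c *\<^sub>C b) = c *\<^sub>C block i j b"
  by (simp add: block_def pure_tensor_scale_right)

lemma block_zero: "block i j 0 = 0"
  by (simp add: block_def pure_tensor_zero)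

lemma matrix_of_sum: "matrix_of (\<Sum>i\<in>I. f i) = (\<Sum>i\<in>I. matrix_of (f i))"
  by (induction I rule: infinite_finite_induct) (simp_all add: zero_cmatrix.rep_eq plus_cmatrix.rep_eq)

lemma block_decomposition:
  fixes X :: "'n::finite cmatrix \<otimes> 'b::complex_vector"
  shows "X = (\<Sum>i\<in>UNIV. \<Sum>j\<in>UNIV. block i j (entry i j X))"
proof (induction X rule: tensor_induct)
  case zero
  show ?case by (simp add: entry_zero block_zero)
next
  case (add X Y)
  then show ?case by (simp add: entry_add block_add sum.distrib)
next
  case (scale c X)
  have "(\<Sum>i\<in>UNIV. \<Sum>j\<in>UNIV. block i j (entry i j (c *\<^sub>C X))) = c *\<^sub>C (\<Sum>i\<in>UNIV. \<Sum>j\<in>UNIV. block i j (entry i j X))"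
    by (simp add: entry_scale block_scale complex_vector.scale_sum_right)
  with scale show ?case by simp
next
  case (pure M b)
  have "mentry M k l = mentry (\<Sum>i\<in>UNIV. \<Sum>j\<in>UNIV. mentry M i j *\<^sub>C matrix_unit i j) k l"
    for k l
  proof -
    have "mentry (\<Sum>i\<in>UNIV. \<Sum>j\<in>UNIV. mentry M i j *\<^sub>C matrix_unit i j) k l
        = (\<Sum>i\<in>UNIV. \<Sum>j\<in>UNIV. mentry M i j * (if k = i \<and> l = j then 1 else 0))"
      by (simp only: matrix_of_sum scaleC_cmatrix.rep_eq sum_component vec_lambda_beta matrix_unit_entry)
    also have "\<dots> = (\<Sum>i\<in>UNIV. if k = i then \<Sum>j\<in>UNIV. if l = j then mentry M i j else 0 else 0)"
      by (intro sum.cong refl if_cong) (simp add: if_distrib cong: if_cong)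
    finally show ?thesis
      by simp
  qed
  then have "M = (\<Sum>i\<in>UNIV. \<Sum>j\<in>UNIV. mentry M i j *\<^sub>C matrix_unit i j)"
    unfolding matrix_of_inject[symmetric] Finite_Cartesian_Product.vec_eq_iff by blast
  then have "pure_tensor M b = pure_tensor (\<Sum>i\<in>UNIV. \<Sum>j\<in>UNIV. mentry M i j *\<^sub>C matrix_unit i j) b"
    by simp
  also have "\<dots> = (\<Sum>i\<in>UNIV. \<Sum>j\<in>UNIV. block i j (entry i j (pure_tensor M b)))"
    by (simp add: pure_tensor_sum_left pure_tensor_scale_left entry_pure block_def pure_tensor_scale_right)
  finally show ?case .
qed

lemma tensor_eqI:
  fixes X Y :: "'n::finite cmatrix \<otimes> 'b::complex_vector"
  assumes "\<And>i j. entry i j X = entry i j Y"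
  shows "X = Y"
  using block_decomposition[of X] block_decomposition[of Y] assms by simp

lemma block_mult:
  fixes b c :: "'b::complex_algebra"
  shows "block i j b * block j l c = (block i l (b * c) :: 'n::finite cmatrix \<otimes> 'b)"
proof (rule tensor_eqI)
  fix p q :: 'n
  have "entry p q (block i j b * block j l c)
      = (\<Sum>k\<in>UNIV. if k = j then if p = i \<and> q = l then b * c else 0 else 0)"
    unfolding entry_mult entry_block by (intro sum.cong) auto
  then show "entry p q (block i j b * block j l c) = entry p q (block i l (b * c))"
    by (simp add: entry_block)
qed

lemma finite_dim_matrix_tensor:
  assumes "finite_dim TYPE('b::complex_vector)"
  shows "finite_dim TYPE('n::finite cmatrix \<otimes> 'b)"
proof -
  obtain S :: "'b set" where S: "finite S" "complex_vector.span S = UNIV"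
    using assms unfolding finite_dim_def by blast
  define T where "T = (\<Union>i\<in>UNIV. \<Union>j\<in>UNIV. block i j ` S :: ('n cmatrix \<otimes> 'b) set)"
  have "block i j b \<in> complex_vector.span T" for i j b
  proof -
    have "b \<in> complex_vector.span S"
      using S(2) by simp
    then show ?thesis
    proof (induction rule: complex_vector.span_induct_alt)
      case base
      show ?case by (simp add: block_zero complex_vector.span_zero)
    next
      case (step c x y)
      then have "block i j x \<in> T" by (auto simp: T_def)
      with step show ?case
        by (simp add: block_add block_scale complex_vector.span_add complex_vector.span_scale complex_vector.span_base)
    qed
  qed
  then have "X \<in> complex_vector.span T" for X
    by (subst block_decomposition) (intro complex_vector.span_sum)
  then show ?thesis
    unfolding finite_dim_def using S(1) by (intro exI[of _ T]) (auto simp: T_def)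
qed

section \<open>Algebras of index one\<close>

text \<open>
  Index one gives a functional whose stabiliser is one-dimensional, hence spanned by the unit, which
  always stabilises.  Moving it along a line in a direction that is nonzero at the unit keeps the
  stabiliser and makes the value at the unit nonzero, for all but finitely many parameters.
\<close>

lemma stab_scalar_functional_exists:
  assumes fd: "finite_dim TYPE('b::complex_algebra_1)" and ind: "alg_index TYPE('b) = 1"
  obtains F :: "'b::complex_algebra_1 \<Rightarrow> complex" where "F \<in> dual_space" "F 1 \<noteq> 0" "\<And>x. x \<in> stab F \<Longrightarrow> \<exists>s. x = s *\<^sub>C 1"
proof -
  obtain F\<^sub>0 :: "'b \<Rightarrow> complex" where F0: "F\<^sub>0 \<in> dual_space" "complex_vector.dim (stab F\<^sub>0) = 1"
    using alg_index_attained ind by metis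
  obtain m and e :: "nat \<Rightarrow> 'b" and co where coord: "coordinates m e co"
    using coordinates_exist[OF fd] .
  obtain i where i: "i < m" "co i 1 \<noteq> 0"
    using coordinates.coordinate_nonzero[OF coord, of 1] by auto
  define K where "K = co i"
  have K: "K \<in> dual_space" "K 1 \<noteq> 0"
    using coordinates.co_dual[OF coord i(1)] i(2) by (auto simp: K_def)
  have "{t. F\<^sub>0 1 + t * K 1 = 0} \<subseteq> {- F\<^sub>0 1 / K 1}"
    using K(2) by (auto simp: field_simps add_eq_0_iff)
  then have "finite ({t. \<not> complex_vector.dim (stab (\<lambda>x. F\<^sub>0 x + t * K x)) \<le> complex_vector.dim (stab F\<^sub>0)}
      \<union> {t. F\<^sub>0 1 + t * K 1 = 0})" (is "finite ?bad")
    using dim_stab_pencil[OF fd F0(1) K(1)] finite_subset by blast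
  then obtain t where "t \<notin> ?bad"
    using ex_new_if_finite infinite_UNIV_char_0 by blast
  then have t: "complex_vector.dim (stab (\<lambda>x. F\<^sub>0 x + t * K x)) \<le> 1" "F\<^sub>0 1 + t * K 1 \<noteq> 0"
    using F0(2) by auto
  define F where "F = (\<lambda>x. F\<^sub>0 x + t * K x)"
  have "\<exists>s. x = s *\<^sub>C 1" if x: "x \<in> stab F" for x
  proof (rule ccontr)
    assume not_scalar: "\<nexists>s. x = s *\<^sub>C 1"
    then have "x \<notin> complex_vector.span {1}"
      by (auto simp: complex_vector.span_singleton)
    then have indep: "complex_vector.independent {x, 1}"
      by (intro complex_vector.independent_insertI complex_vector.independent_empty) auto
    obtain B :: "'b set" where "finite B" "complex_vector.independent B" "complex_vector.span B = UNIV"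
      using finite_basis_exists[OF fd] .
    then interpret W: finite_dimensional_vector_space "scaleC :: complex \<Rightarrow> 'b \<Rightarrow> 'b" B
      by unfold_locales
    have "{x, 1} \<subseteq> stab F"
      using x by (auto simp: stab_def)
    then have "card {x, 1} \<le> complex_vector.dim (stab F)"
      using indep by (rule W.independent_card_le_dim)
    moreover have "x \<noteq> 1"
      using not_scalar scaleC_one[of 1] by metis
    ultimately show False
      using t(1) by (simp add: F_def)
  qed
  moreover have "F \<in> dual_space"
    using dual_combination[OF F0(1) K(1), of 1 t] by (simp add: F_def)
  ultimately show ?thesis
    using that[of F] t(2) by (simp add: F_def)
qed

text \<open>
  The normalisation \<open>F 1 \<noteq> 0\<close> makes the pencil of \<open>F\<close> regular.  Testing a twisted stabilising element
  \<open>x\<close> against the unit gives \<open>F x = c * F x\<close>, so \<open>F x = 0\<close> when \<open>c \<noteq> 1\<close>.  If all twists were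
  nontrivial, letting \<open>c\<close> tend to \<open>1\<close> would produce a nonzero element of the stabiliser on which \<open>F\<close>
  vanishes; but it is a scalar.
\<close>

lemma finite_nontrivial_stab_at_scalar:
  fixes F :: "'b::complex_algebra_1 \<Rightarrow> complex"
  assumes fd: "finite_dim TYPE('b)" and F: "F \<in> dual_space" "F 1 \<noteq> 0"
    and scalar: "\<And>x. x \<in> stab F \<Longrightarrow> \<exists>s. x = s *\<^sub>C 1"
  shows "finite {c. stab_at F c \<noteq> {0}}"
proof -
  define c where "c = (\<lambda>k. 1 + complex_of_real (inverse (real (Suc k))))"
  have "(\<lambda>k. 1 + complex_of_real (inverse (real (Suc k)))) \<longlonglongrightarrow> 1 + complex_of_real 0"
    by (intro tendsto_intros LIMSEQ_inverse_real_of_nat)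
  then have c: "c \<longlonglongrightarrow> 1"
    by (simp add: c_def)
  have c1: "c k \<noteq> 1" for k
    by (simp add: c_def del: of_nat_Suc)
  have "\<exists>k. stab_at F (c k) = {0}"
  proof (rule ccontr)
    assume "\<not> ?thesis"
    then have nontriv: "stab_at F (c k) \<noteq> {0}" for k by blast
    obtain r x a where "strict_mono r" and x: "\<And>k. x k \<in> stab_at F (c (r k))"
        and a: "a \<in> stab_at F 1" "a \<noteq> 0" "weakly_tendsto x a"
      by (rule stab_at_limit[where H = "\<lambda>_. F" and G = F, OF fd F(1) F(1) tendsto_const c nontriv]) (rule that)
    have "F (x k) = 0" for k
    proof -
      have "F (x k * 1) = c (r k) * F (1 * x k)"
        using x[of k] unfolding stab_at_def by blast
      then show ?thesis using c1[of "r k"] by simp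
    qed
    then have "F a = 0"
      using weakly_tendstoD[OF a(3) F(1)] by (simp add: LIMSEQ_const_iff)
    moreover obtain s where s: "a = s *\<^sub>C 1"
      using scalar a(1) unfolding stab_eq_stab_at by blast
    ultimately show False
      using a(2) F(2) by (simp add: dual_scale[OF F(1)])
  qed
  then show ?thesis
    using finite_nontrivial_stab_at[OF fd F(1)] by blast
qed

text \<open>
  The powers of three form a Sidon set: \<open>2 * 3 ^ n < 3 ^ Suc n\<close> shows that a sum of two of them
  determines the larger exponent.
\<close>

lemma three_powers_sum_eq:
  fixes a b c d :: nat
  assumes "(3::nat) ^ a + 3 ^ b = 3 ^ c + 3 ^ d"
  shows "(a = c \<and> b = d) \<or> (a = d \<and> b = c)"
proof -
  have max_le: "max a' b' \<le> max c' d'" if "(3::nat) ^ a' + 3 ^ b' = 3 ^ c' + 3 ^ d'" for a' b' c' d' :: nat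
  proof (rule ccontr)
    assume "\<not> ?thesis"
    then have lt: "Suc (max c' d') \<le> max a' b'" by linarith
    have "(3::nat) ^ c' \<le> 3 ^ max c' d'" "(3::nat) ^ d' \<le> 3 ^ max c' d'"
      by (auto intro: power_increasing)
    moreover have "(3::nat) ^ Suc (max c' d') \<le> 3 ^ max a' b'"
      using lt by (rule power_increasing) simp
    moreover have "(3::nat) ^ max a' b' \<le> 3 ^ a' + 3 ^ b'"
      by (simp add: max_def)
    moreover have "(0::nat) < 3 ^ max c' d'" by simp
    ultimately show False
      using that unfolding power_Suc by linarith
  qed
  have max_eq: "max a b = max c d"
    by (intro antisym max_le[OF assms] max_le[OF assms[symmetric]])
  have inj: "(3::nat) ^ x = 3 ^ y \<Longrightarrow> x = y" for x y :: nat by simp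
  consider "a = c" | "a = d" | "b = c" | "b = d"
    using max_eq by (auto simp: max_def split: if_splits)
  then show ?thesis
    using assms by cases (auto dest: inj)
qed

lemma exists_ratio_avoiding_scalar:
  fixes C :: "complex set"
  assumes "finite C"
  obtains \<tau> :: complex where "\<tau> \<noteq> 0" "\<And>p q. p \<noteq> q \<Longrightarrow> \<tau> ^ p / \<tau> ^ q \<notin> C"
proof -
  \<comment> \<open>Powers of a real number exceeding all \<open>norm c\<close> and \<open>norm (inverse c)\<close> have ratios that are
    either too large or too small to lie in \<open>C\<close>.\<close>
  define R where "R = 2 + (\<Sum>c\<in>C. norm c + norm (inverse c))"
  have R: "norm c < R" "norm (inverse c) < R" if "c \<in> C" for c
  proof -
    have "norm c + norm (inverse c) \<le> (\<Sum>c\<in>C. norm c + norm (inverse c))"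
      using assms that by (intro member_le_sum) auto
    then show "norm c < R" "norm (inverse c) < R"
      unfolding R_def using norm_ge_zero[of c] norm_ge_zero[of "inverse c"] by linarith+
  qed
  have R2: "R \<ge> 2"
    unfolding R_def by (simp add: sum_nonneg)
  have ge: "R \<le> R ^ p / R ^ q" if "q < p" for p q :: nat
  proof -
    have "R ^ p / R ^ q = R ^ (p - q)"
      using R2 that by (simp add: power_diff)
    moreover have "R ^ 1 \<le> R ^ (p - q)"
      using R2 that by (intro power_increasing) auto
    ultimately show ?thesis by simp
  qed
  have "complex_of_real R ^ p / complex_of_real R ^ q \<notin> C" if "p \<noteq> q" for p q :: nat
  proof
    let ?c = "complex_of_real R ^ p / complex_of_real R ^ q"
    assume c: "?c \<in> C"
    have "norm ?c = R ^ p / R ^ q" "norm (inverse ?c) = R ^ q / R ^ p"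
      using R2 by (simp_all add: norm_divide norm_power norm_inverse)
    then show False
      using R[OF c] ge[of p q] ge[of q p] that by (cases "p < q") auto
  qed
  then show ?thesis
    using that[of "complex_of_real R"] R2 by auto
qed

section \<open>Diagonal functionals with generic weights\<close>

definition diagonal_functional ::
  "('n::finite \<Rightarrow> complex) \<Rightarrow> ('b::complex_vector \<Rightarrow> complex) \<Rightarrow> 'n cmatrix \<otimes> 'b \<Rightarrow> complex" where
  "diagonal_functional t F X = (\<Sum>i\<in>UNIV. t i * F (entry i i X))"

lemma diagonal_functional_dual: "F \<in> dual_space \<Longrightarrow> diagonal_functional t F \<in> dual_space"
  by (auto simp: dual_space_iff diagonal_functional_def entry_add entry_scale algebra_simps sum.distrib
      sum_distrib_left)

text \<open>
  Testing \<open>X\<close> against a matrix with a single nonzero entry, at \<open>(l, k)\<close>, isolates the entry of \<open>X\<close> at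
  \<open>(k, l)\<close>.  The two products contribute to the diagonal at \<open>k\<close> and at \<open>l\<close> respectively, which brings
  in the weights \<open>t k\<close> and \<open>t l\<close>.
\<close>

lemma stab_at_diagonal_functional:
  fixes F :: "'b::complex_algebra \<Rightarrow> complex" and X :: "'n::finite cmatrix \<otimes> 'b"
  assumes F: "F \<in> dual_space" and t: "\<And>i. t i \<noteq> 0"
  shows "X \<in> stab_at (diagonal_functional t F) c \<longleftrightarrow>
    (\<forall>k l. entry k l X \<in> stab_at F (c * t l / t k))"
proof -
  have XY: "diagonal_functional t F (X * Y) = (\<Sum>k\<in>UNIV. \<Sum>l\<in>UNIV. t k * F (entry k l X * entry l k Y))" for Y
    by (simp add: diagonal_functional_def entry_mult dual_sum[OF F] sum_distrib_left)
  have YX: "diagonal_functional t F (Y * X) = (\<Sum>k\<in>UNIV. \<Sum>l\<in>UNIV. t l * F (entry l k Y * entry k l X))" for Y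
    by (subst sum.swap) (simp add: diagonal_functional_def entry_mult dual_sum[OF F] sum_distrib_left)
  show ?thesis
  proof
    assume X: "X \<in> stab_at (diagonal_functional t F) c"
    show "\<forall>k l. entry k l X \<in> stab_at F (c * t l / t k)"
    proof (intro allI)
      fix k l
      have "F (entry k l X * y) = c * t l / t k * F (y * entry k l X)" for y
      proof -
        have single: "(\<Sum>i\<in>UNIV. \<Sum>j\<in>UNIV. if j = l \<and> i = k then f i j else 0) = f k l"
          for f :: "'n \<Rightarrow> 'n \<Rightarrow> complex"
        proof -
          have "(\<Sum>i\<in>UNIV. \<Sum>j\<in>UNIV. if j = l \<and> i = k then f i j else 0)
              = (\<Sum>i\<in>UNIV. if i = k then \<Sum>j\<in>UNIV. if j = l then f i j else 0 else 0)"
            by (intro sum.cong) auto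
          then show ?thesis by simp
        qed
        have "diagonal_functional t F (X * block l k y) = t k * F (entry k l X * y)"
          unfolding XY entry_block
          using single[of "\<lambda>i j. t i * F (entry i j X * y)"]
          by (simp add: if_distrib dual_zero[OF F] cong: if_cong)
        moreover have "diagonal_functional t F (block l k y * X) = t l * F (y * entry k l X)"
          unfolding YX entry_block
          using single[of "\<lambda>i j. t j * F (y * entry i j X)"]
          by (simp add: if_distrib if_distribR dual_zero[OF F] cong: if_cong)
        moreover have "diagonal_functional t F (X * block l k y) = c * diagonal_functional t F (block l k y * X)"
          using X unfolding stab_at_def by blast
        ultimately show ?thesis
          using t[of k] by (simp add: field_simps)
      qed
      then show "entry k l X \<in> stab_at F (c * t l / t k)"
        unfolding stab_at_def by blast
    qed
  next
    assume entries: "\<forall>k l. entry k l X \<in> stab_at F (c * t l / t k)"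
    have "t k * F (entry k l X * y) = c * (t l * F (y * entry k l X))" for k l y
    proof -
      have "F (entry k l X * y) = c * t l / t k * F (y * entry k l X)"
        using entries unfolding stab_at_def by blast
      then show ?thesis using t[of k] by (simp add: field_simps)
    qed
    then have "diagonal_functional t F (X * Y) = c * diagonal_functional t F (Y * X)" for Y
      unfolding XY YX by (simp add: sum_distrib_left)
    then show "X \<in> stab_at (diagonal_functional t F) c"
      unfolding stab_at_def by blast
  qed
qed

text \<open>
  Genericity of the diagonal weights.  An entry at \<open>(k, l)\<close> of an element with twist \<open>t i / t j\<close> sees
  the twist \<open>t i * t l / (t j * t k)\<close>.  This is \<open>1\<close> for trivial reasons if \<open>(k, l) = (i, j)\<close>, or if
  \<open>i = j\<close> and \<open>k = l\<close>; in all other cases it is required to be a twist without nonzero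
  stabilising elements.
\<close>

locale generic_diagonal =
  fixes F :: "'b::complex_algebra_1 \<Rightarrow> complex" and t :: "'n::finite \<Rightarrow> complex"
  assumes fd: "finite_dim TYPE('b)"
    and F: "F \<in> dual_space" "F 1 \<noteq> 0"
    and scalar: "\<And>x. x \<in> stab F \<Longrightarrow> \<exists>s. x = s *\<^sub>C 1"
    and t_nonzero: "t i \<noteq> 0"
    and generic: "\<lbrakk>i \<noteq> k \<or> j \<noteq> l; i \<noteq> j \<or> l \<noteq> k\<rbrakk> \<Longrightarrow> stab_at F (t i * t l / (t j * t k)) = {0}"
begin

definition G :: "'n cmatrix \<otimes> 'b \<Rightarrow> complex" where
  "G = diagonal_functional t F"

lemma G_dual: "G \<in> dual_space"
  unfolding G_def using F(1) by (rule diagonal_functional_dual)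

lemma stab_at_G_iff: "X \<in> stab_at G c \<longleftrightarrow> (\<forall>k l. entry k l X \<in> stab_at F (c * t l / t k))"
  unfolding G_def using F(1) t_nonzero by (rule stab_at_diagonal_functional)

lemma stab_at_G_trivial: "\<exists>d. stab_at G d = {0}"
proof -
  have "finite (\<Union>k. \<Union>l. (\<lambda>c. c * t k / t l) ` {c. stab_at F c \<noteq> {0}})"
    using finite_nontrivial_stab_at_scalar[OF fd F scalar] by simp
  then obtain d where d: "d \<notin> (\<Union>k. \<Union>l. (\<lambda>c. c * t k / t l) ` {c. stab_at F c \<noteq> {0}})"
    using ex_new_if_finite[OF infinite_UNIV_char_0] by blast
  have "stab_at F (d * t l / t k) = {0}" for k l
  proof (rule ccontr)
    assume "stab_at F (d * t l / t k) \<noteq> {0}"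
    moreover have "d = (d * t l / t k) * t k / t l"
      using t_nonzero[of k] t_nonzero[of l] by simp
    ultimately show False
      using d by blast
  qed
  then have "X = 0" if "X \<in> stab_at G d" for X
    using that by (intro tensor_eqI) (auto simp: stab_at_G_iff entry_zero)
  then show ?thesis
    using zero_in_stab_at[OF G_dual] by blast
qed

text \<open>
  For \<open>i = j\<close> the twist is \<open>1\<close> and the stabiliser contains all scalar diagonal matrices, so it is a
  line only for matrices of size one; this is the case that the second alternative admits.
\<close>

lemma stab_at_G_ratio:
  assumes X: "X \<in> stab_at G (t i / t j)" and ij: "i \<noteq> j \<or> (\<forall>k. k = i)"
  shows "\<exists>s. X = s *\<^sub>C block i j 1"
proof -
  have e: "entry k l X \<in> stab_at F (t i * t l / (t j * t k))" for k l
  proof -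
    have "t i / t j * t l / t k = t i * t l / (t j * t k)" by simp
    then show ?thesis
      using X unfolding stab_at_G_iff by metis
  qed
  have off: "entry k l X = 0" if "k \<noteq> i \<or> l \<noteq> j" for k l
    using e[of k l] generic[of i k j l] that ij by (metis singletonD)
  have "entry i j X \<in> stab F"
    using e[of i j] t_nonzero[of i] t_nonzero[of j] by (simp add: stab_eq_stab_at mult.commute)
  then obtain s where "entry i j X = s *\<^sub>C 1"
    using scalar by blast
  then have "X = s *\<^sub>C block i j 1"
    by (intro tensor_eqI) (auto simp: off entry_scale entry_block)
  then show ?thesis ..
qed

lemma block_in_stab_at_G: "block i j 1 \<in> stab_at G (t i / t j)"
proof -
  have "1 \<in> stab_at F 1"
    by (simp add: stab_at_def)
  then show ?thesis
    using t_nonzero zero_in_stab_at[OF F(1)] by (auto simp: stab_at_G_iff entry_block)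
qed

lemma dim_stab_G_le: "complex_vector.dim (stab G) \<le> CARD('n)"
proof -
  have "X \<in> complex_vector.span (range (\<lambda>k. block k k 1))" if X: "X \<in> stab G" for X
  proof -
    have e: "entry k l X \<in> stab_at F (t l / t k)" for k l
      using X unfolding stab_eq_stab_at stab_at_G_iff by simp
    have off: "entry k l X = 0" if "k \<noteq> l" for k l
    proof -
      have "stab_at F (t k * t l / (t k * t k)) = {0}"
        by (rule generic) (use that in auto)
      then show ?thesis
        using e[of k l] t_nonzero[of k] by simp
    qed
    have "\<exists>s. entry k k X = s *\<^sub>C 1" for k
      using e[of k k] t_nonzero[of k] scalar by (simp add: stab_eq_stab_at)
    then obtain s where s: "\<And>k. entry k k X = s k *\<^sub>C 1" by metis
    have "X = (\<Sum>k\<in>UNIV. \<Sum>l\<in>UNIV. block k l (entry k l X))"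
      by (rule block_decomposition)
    also have "\<dots> = (\<Sum>k\<in>UNIV. \<Sum>l\<in>UNIV. if l = k then s k *\<^sub>C block k k 1 else 0)"
      by (intro sum.cong refl) (auto simp: off s block_zero block_scale)
    also have "\<dots> = (\<Sum>k\<in>UNIV. s k *\<^sub>C block k k 1)"
      by simp
    also have "\<dots> \<in> complex_vector.span (range (\<lambda>k. block k k 1))"
      by (intro complex_vector.span_sum complex_vector.span_scale complex_vector.span_base) auto
    finally show ?thesis .
  qed
  then have "complex_vector.dim (stab G) \<le> card (range (\<lambda>k. block k k 1 :: 'n cmatrix \<otimes> 'b))"
    by (intro complex_vector.dim_le_card) auto
  also have "\<dots> \<le> CARD('n)"
    by (rule card_image_le) simp
  finally show ?thesis .
qed

text \<open>
  For each \<open>i\<close> choose \<open>j\<close> different from \<open>i\<close>, or equal to \<open>i\<close> for matrices of size one.  The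
  product of the matrix units at \<open>(i, j)\<close> and
  \<open>(j, i)\<close> is the diagonal one at \<open>(i, i)\<close>, so \<open>approximate_stabiliser\<close> yields an element of the
  stabiliser close to each diagonal matrix unit.
\<close>

lemma dim_stab_ge_near_G:
  assumes H: "\<And>k. H k \<in> dual_space" "\<And>X. (\<lambda>k. H k X) \<longlonglongrightarrow> G X"
  shows "\<forall>\<^sub>F k in sequentially. CARD('n) \<le> complex_vector.dim (stab (H k))"
proof -
  define \<phi> :: "'n \<Rightarrow> 'n cmatrix \<otimes> 'b \<Rightarrow> complex"
    where "\<phi> = (\<lambda>j X. F (entry j j X) / F 1)"
  have \<phi>: "\<phi> j \<in> dual_space" for j
    using F(1) by (auto simp: \<phi>_def dual_space_iff entry_add entry_scale add_divide_distrib)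
  have \<phi>_block: "\<phi> j (block i i 1) = (if i = j then 1 else 0)" for i j
    using F(2) by (simp add: \<phi>_def entry_block dual_zero[OF F(1)])
  have fdA: "finite_dim TYPE('n cmatrix \<otimes> 'b)"
    using fd by (rule finite_dim_matrix_tensor)
  obtain d where d: "stab_at G d = {0}"
    using stab_at_G_trivial ..
  have "\<forall>\<^sub>F k in sequentially. \<exists>z\<in>stab (H k). \<forall>j. dist (\<phi> j z) (if i = j then 1 else 0) < 1 / CARD('n)" for i
  proof -
    obtain j where j: "i \<noteq> j \<or> (\<forall>k. k = i)" by metis
    then have ji: "j \<noteq> i \<or> (\<forall>k. k = j)" by metis
    have "entry i j (block i j (1::'b)) \<noteq> entry i j 0"
      by (simp add: entry_block entry_zero)
    then have nz: "block i j (1::'b) \<noteq> 0" by metis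
    have "\<forall>\<^sub>F k in sequentially. \<exists>z\<in>stab (H k). \<forall>f\<in>range \<phi>.
        dist (f z) (f (block i j 1 * block j i 1)) < 1 / CARD('n)"
    proof (rule approximate_stabiliser[OF fdA H(1) G_dual H(2) _ d nz])
      show "t i / t j \<noteq> 0"
        using t_nonzero by simp
      show "block i j 1 \<in> stab_at G (t i / t j)"
        by (rule block_in_stab_at_G)
      show "\<exists>s. X = s *\<^sub>C block i j 1" if "X \<in> stab_at G (t i / t j)" for X
        using that j by (rule stab_at_G_ratio)
      show "\<exists>s. X = s *\<^sub>C block j i 1" if "X \<in> stab_at G (inverse (t i / t j))" for X
        using that ji by (intro stab_at_G_ratio) simp_all
    qed (use \<phi> in auto)
    then show ?thesis
      by (simp add: block_mult \<phi>_block)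
  qed
  then have "\<forall>\<^sub>F k in sequentially. \<forall>i. \<exists>z\<in>stab (H k). \<forall>j. dist (\<phi> j z) (if i = j then 1 else 0) < 1 / CARD('n)"
    by (rule eventually_all_finite)
  then show ?thesis
  proof eventually_elim
    case (elim k)
    then obtain z where z: "\<And>i. z i \<in> stab (H k)"
        "\<And>i j. dist (\<phi> j (z i)) (if i = j then 1 else 0) < 1 / CARD('n)"
      by metis
    show ?case
      using fdA \<phi> z by (rule near_dual_family_dim_ge)
  qed
qed

text \<open>
  The bound near \<open>G\<close> spreads to every functional \<open>K\<close> along the line from \<open>K\<close> to \<open>G\<close>: points of this
  line converging to \<open>G\<close> eventually have a stabiliser of dimension at least \<open>n\<close>, and all but finitely
  many points of the line have one of dimension at most that of \<open>K\<close>.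
\<close>

lemma dim_stab_ge:
  fixes K :: "'n cmatrix \<otimes> 'b \<Rightarrow> complex"
  assumes "K \<in> dual_space"
  shows "CARD('n) \<le> complex_vector.dim (stab K)"
proof -
  have fdA: "finite_dim TYPE('n cmatrix \<otimes> 'b)"
    using fd by (rule finite_dim_matrix_tensor)
  define D where "D = (\<lambda>X. G X - K X)"
  have D: "D \<in> dual_space"
    using dual_combination[OF G_dual assms, of 1 "-1"] by (simp add: D_def)
  define u where "u = (\<lambda>k. 1 - complex_of_real (inverse (real (Suc k))))"
  have "(\<lambda>k. 1 - complex_of_real (inverse (real (Suc k)))) \<longlonglongrightarrow> 1 - complex_of_real 0"
    by (intro tendsto_intros LIMSEQ_inverse_real_of_nat)
  then have u: "u \<longlonglongrightarrow> 1"
    by (simp add: u_def)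
  define H where "H = (\<lambda>k X. K X + u k * D X)"
  have H: "H k \<in> dual_space" for k
    using dual_combination[OF assms D, of 1 "u k"] by (simp add: H_def)
  have "(\<lambda>k. H k X) \<longlonglongrightarrow> K X + 1 * D X" for X
    unfolding H_def by (intro tendsto_intros u)
  then have "(\<lambda>k. H k X) \<longlonglongrightarrow> G X" for X
    by (simp add: D_def)
  with H have "\<forall>\<^sub>F k in sequentially. CARD('n) \<le> complex_vector.dim (stab (H k))"
    by (rule dim_stab_ge_near_G)
  moreover have "\<forall>\<^sub>F k in sequentially. complex_vector.dim (stab (H k)) \<le> complex_vector.dim (stab K)"
  proof -
    have "inj u"
      by (auto simp: inj_def u_def)
    then have "finite (u -` {s. \<not> complex_vector.dim (stab (\<lambda>X. K X + s * D X)) \<le> complex_vector.dim (stab K)})"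
      using dim_stab_pencil[OF fdA assms D] by (intro finite_vimageI)
    then show ?thesis
      by (simp add: vimage_def H_def eventually_cofinite flip: cofinite_eq_sequentially)
  qed
  ultimately have "\<forall>\<^sub>F k in sequentially. CARD('n) \<le> complex_vector.dim (stab K)"
    by eventually_elim (rule order_trans)
  then show ?thesis by simp
qed

lemma alg_index_matrix_tensor: "alg_index TYPE('n cmatrix \<otimes> 'b) = CARD('n)"
proof -
  have fdA: "finite_dim TYPE('n cmatrix \<otimes> 'b)"
    using fd by (rule finite_dim_matrix_tensor)
  obtain K :: "'n cmatrix \<otimes> 'b \<Rightarrow> complex" where K: "one_regular K" "K \<in> dual_space"
      "complex_vector.dim (stab K) = alg_index TYPE('n cmatrix \<otimes> 'b)"
    by (rule alg_index_attained)
  have "complex_vector.dim (stab K) \<le> CARD('n)"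
    using one_regular_minimal[OF fdA K(1) G_dual] dim_stab_G_le by linarith
  then show ?thesis
    using dim_stab_ge[OF K(2)] K(3) by linarith
qed

end

section \<open>The index of matrices over an algebra of index one\<close>

theorem corollary2:
  assumes "finite_dim TYPE('b::complex_algebra_1)"
    and "alg_index TYPE('b) = 1"
  shows "alg_index TYPE('n::finite cmatrix \<otimes> 'b) = CARD('n)"
proof -
  obtain F :: "'b \<Rightarrow> complex" where F: "F \<in> dual_space" "F 1 \<noteq> 0"
      and scalar: "\<And>x. x \<in> stab F \<Longrightarrow> \<exists>s. x = s *\<^sub>C 1"
    by (rule stab_scalar_functional_exists[OF assms]) (rule that)
  have fin: "finite {c. stab_at F c \<noteq> {0}}"
    using assms(1) F scalar by (rule finite_nontrivial_stab_at_scalar)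
  obtain \<tau> where \<tau>: "\<tau> \<noteq> 0" "\<And>p q. p \<noteq> q \<Longrightarrow> \<tau> ^ p / \<tau> ^ q \<notin> {c. stab_at F c \<noteq> {0}}"
    by (rule exists_ratio_avoiding_scalar[OF fin]) (rule that)
  obtain h :: "'n \<Rightarrow> nat" where h: "inj h"
    using finite_imp_inj_to_nat_seg[of "UNIV :: 'n set"] by auto
  \<comment> \<open>A Sidon set of exponents makes every nontrivial ratio \<open>t i * t l / (t j * t k)\<close> a ratio of two
    different powers of \<open>\<tau>\<close>.\<close>
  define t where "t = (\<lambda>i. \<tau> ^ 3 ^ h i)"
  interpret generic_diagonal F t
  proof
    fix i j k l :: 'n
    assume ne: "i \<noteq> k \<or> j \<noteq> l" "i \<noteq> j \<or> l \<noteq> k"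
    have "(3::nat) ^ h i + 3 ^ h l \<noteq> 3 ^ h j + 3 ^ h k"
    proof
      assume "(3::nat) ^ h i + 3 ^ h l = 3 ^ h j + 3 ^ h k"
      then have "(h i = h j \<and> h l = h k) \<or> (h i = h k \<and> h l = h j)"
        by (rule three_powers_sum_eq)
      then show False
        using ne injD[OF h] by blast
    qed
    then show "stab_at F (t i * t l / (t j * t k)) = {0}"
      using \<tau>(2) by (simp add: t_def flip: power_add)
  qed (use assms(1) F scalar \<tau>(1) in \<open>simp_all add: t_def\<close>)
  show ?thesis
    by (rule alg_index_matrix_tensor)
qed

end
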